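(* Let $\mu$ be a probability measure on $E$. For any diffeomorphism $\psi:E\to\mathbb{R}^n$, $$I_\mu^\psi=I_{\psi_*\mu}^{\mathrm{id}}.$$ In particular, if $\psi_*\mu=\gamma$ is the standard Gaussian measure on $\mathbb{R}^n$, then $I_\mu^\psi(v)=\varphi(\Phi^{-1}(v))$ for $v\in(0,1)$.
   Context: The pushforward is $(\psi_*\mu)(B)=\mu(\psi^{-1}(B))$. The $\psi$-distance on $E$ is $d_\psi(x,y)=\|\psi(x)-\psi(y)\|_2$, and $d_\psi(x,A)=\inf_{y\in A}d_\psi(x,y)$. For a measurable set $A\subseteq E$, the $\psi$-perimeter is $$\mu^{+,\psi}(A):=\liminf_{\epsilon\to0^+}\frac{\mu(A_\epsilon^\psi)-\mu(A)}{\epsilon},\qquad A_\epsilon^\psi=\{x\in E:d_\psi(x,A)<\epsilon\}.$$ The $\psi$-isoperimetric profile of $\mu$ is $I_\mu^\psi(v):=\inf\{\mu^{+,\psi}(A):A\subseteq E\text{ measurable},\ \mu(A)=v\}$. For a measure $\nu$ on $\mathbb{R}^n$, $I_\nu^{\mathrm{id}}$ is the same with $E=\mathbb{R}^n$ and $\psi=\mathrm{id}$. $\varphi$ and $\Phi$ denote the density and distribution function of the standard normal law on $\mathbb{R}$. *)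

theory Defs
  imports "HOL-Probability.Probability"
begin

section \<open>Manifolds and diffeomorphisms of class C^k, k \<in> {1, 2, ..., \<infinity>}\<close>

text \<open>To be used on open sets only: the derivative in the recursive case is the unrestricted
  one.\<close>

fun cont_diff_on :: "nat \<Rightarrow> 'a set \<Rightarrow> ('a::euclidean_space \<Rightarrow> 'b::euclidean_space) \<Rightarrow> bool" where
  "cont_diff_on 0 S f \<longleftrightarrow> continuous_on S f"
| "cont_diff_on (Suc k) S f \<longleftrightarrow>
     (\<forall>x\<in>S. f differentiable (at x)) \<and>
     (\<forall>v. cont_diff_on k S (\<lambda>x. frechet_derivative f (at x) v))"

definition Ck_on :: "enat \<Rightarrow> 'a set \<Rightarrow> ('a::euclidean_space \<Rightarrow> 'b::euclidean_space) \<Rightarrow> bool" where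
  "Ck_on k S f \<longleftrightarrow> (\<forall>j. enat j \<le> k \<longrightarrow> cont_diff_on j S f)"

text \<open>A chart is a pair of its domain and its coordinate map; the coordinate map is irrelevant
  outside the domain.\<close>

type_synonym ('a, 'e) chart = "'a set \<times> ('a \<Rightarrow> 'e)"

definition is_chart :: "'a topology \<Rightarrow> ('a, 'e::euclidean_space) chart \<Rightarrow> bool" where
  "is_chart X = (\<lambda>(U, p). openin X U \<and> open (p ` U) \<and>
     homeomorphic_map (subtopology X U) (top_of_set (p ` U)) p)"

definition Ck_manifold ::
  "enat \<Rightarrow> 'a topology \<Rightarrow> ('a, 'e::euclidean_space) chart set \<Rightarrow> bool" where
  "Ck_manifold k X \<A> \<longleftrightarrow>
     Hausdorff_space X \<and> second_countable X \<and>
     (\<forall>c\<in>\<A>. is_chart X c) \<and>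
     (\<Union>(U, p)\<in>\<A>. U) = topspace X \<and>
     (\<forall>(U, p)\<in>\<A>. \<forall>(V, q)\<in>\<A>. Ck_on k (p ` (U \<inter> V)) (q \<circ> inv_into U p))"

definition Ck_map ::
  "enat \<Rightarrow> 'a topology \<Rightarrow> ('a, 'e::euclidean_space) chart set \<Rightarrow>
   'b topology \<Rightarrow> ('b, 'f::euclidean_space) chart set \<Rightarrow> ('a \<Rightarrow> 'b) \<Rightarrow> bool" where
  "Ck_map k X \<A> Y \<B> f \<longleftrightarrow>
     continuous_map X Y f \<and>
     (\<forall>(U, p)\<in>\<A>. \<forall>(V, q)\<in>\<B>.
        Ck_on k (p ` {x \<in> U. f x \<in> V}) (q \<circ> f \<circ> inv_into U p))"

definition Ck_diffeomorphism ::
  "enat \<Rightarrow> 'a topology \<Rightarrow> ('a, 'e::euclidean_space) chart set \<Rightarrow>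
   'b topology \<Rightarrow> ('b, 'f::euclidean_space) chart set \<Rightarrow> ('a \<Rightarrow> 'b) \<Rightarrow> bool" where
  "Ck_diffeomorphism k X \<A> Y \<B> f \<longleftrightarrow>
     Ck_map k X \<A> Y \<B> f \<and>
     (\<exists>g. Ck_map k Y \<B> X \<A> g \<and>
          (\<forall>x\<in>topspace X. g (f x) = x) \<and> (\<forall>y\<in>topspace Y. f (g y) = y))"

definition euclidean_atlas :: "('e, 'e::euclidean_space) chart set" where
  "euclidean_atlas = {(UNIV, id)}"

section \<open>Isoperimetric profiles\<close>

text \<open>The Borel \<open>\<sigma>\<close>-algebra of an abstract topology.\<close>

definition borel_of :: "'a topology \<Rightarrow> 'a measure" where
  "borel_of X = sigma (topspace X) {U. openin X U}"

text \<open>In the following the space \<open>E\<close> is \<^term>\<open>space M\<close>, and the measurable sets are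
  \<^term>\<open>sets M\<close>.\<close>

definition psi_dist :: "('a \<Rightarrow> real ^ 'n) \<Rightarrow> 'a \<Rightarrow> 'a \<Rightarrow> real" where
  "psi_dist \<psi> x y = norm (\<psi> x - \<psi> y)"

text \<open>Extended-real valued, so that the distance to the empty set is \<open>\<infinity>\<close>; the library's real-valued
  \<^const>\<open>infdist\<close> would give 0 and turn the enlargement of the empty set into the whole space.\<close>

definition psi_setdist :: "('a \<Rightarrow> real ^ 'n) \<Rightarrow> 'a \<Rightarrow> 'a set \<Rightarrow> ereal" where
  "psi_setdist \<psi> x A = (INF y\<in>A. ereal (psi_dist \<psi> x y))"

definition psi_enlargement ::
  "'a measure \<Rightarrow> ('a \<Rightarrow> real ^ 'n) \<Rightarrow> real \<Rightarrow> 'a set \<Rightarrow> 'a set" where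
  "psi_enlargement M \<psi> \<epsilon> A = {x \<in> space M. psi_setdist \<psi> x A < ereal \<epsilon>}"

definition psi_perimeter :: "'a measure \<Rightarrow> ('a \<Rightarrow> real ^ 'n) \<Rightarrow> 'a set \<Rightarrow> ereal" where
  "psi_perimeter M \<psi> A =
     Liminf (at_right 0)
       (\<lambda>\<epsilon>. ereal ((measure M (psi_enlargement M \<psi> \<epsilon> A) - measure M A) / \<epsilon>))"

definition iso_profile :: "'a measure \<Rightarrow> ('a \<Rightarrow> real ^ 'n) \<Rightarrow> real \<Rightarrow> ereal" where
  "iso_profile M \<psi> v = Inf {psi_perimeter M \<psi> A | A. A \<in> sets M \<and> measure M A = v}"

definition std_gaussian :: "(real ^ 'n) measure" where
  "std_gaussian =
     density lborel (\<lambda>x. ennreal (exp (- (norm x)\<^sup>2 / 2) / sqrt (2 * pi) ^ CARD('n)))"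

definition Phi :: "real \<Rightarrow> real" where
  "Phi = cdf std_normal_distribution"

end

(* A diffeomorphism psi transports Borel sets, their measures and their enlargements, which gives
   the equality of the profiles. For the Gaussian value, half-spaces give the upper bound, and the
   lower bound follows from Bobkov's inequality I(E f) <= E sqrt (I(f)^2 + |grad f|^2), where
   I = phi o Phi^-1, applied to a mollified plateau function that is 1 on A and 0 off the
   eps-enlargement of A.

   Bobkov's inequality is obtained from the heat semigroup. As I'' = -1/I, a Taylor expansion gives
   it for Gaussian noise of size t up to an error O(t^3), uniformly over all f with values in a
   compact part of (0,1) and a gradient that is bounded and Lipschitz; the heat semigroup preserves
   this class. By Minkowski's inequality, passing from t to sqrt 2 * t at most doubles the error.
   So noise of size 1, reached from size 2^(-k/2) after k doublings, has error at most
   2^k O(2^(-3k/2)), which tends to 0. *)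

theory Submission
  imports Defs
begin

section \<open>Transport of the profile\<close>

text \<open>The obstacle sits at the endpoints. I tends to 0 at 0 and 1, and its derivatives I'' =
  -1/I and I''' = -Phi^-1/I^2 blow up there, so no expansion is uniform over functions with values
  in all of (0,1). Values are therefore confined to [Phi(-r), Phi r], where I >= \<phi> r. The price
  is an extra \<phi> r in the final estimate, and r tends to infinity only after Bobkov's inequality
  has been applied. An error of order t^3 is small enough because noise of size t has variance t^2:
  reaching variance 1 takes t^-2 steps, so any error of smaller order than t^2 per step disappears.
  The terms of order t^2 balance because I I'' = -1: the spread of f lowers the mean of I(f), and to
  this order the gradient under the square root makes up for it. Gradients are described by
  inequalities rather than derivatives. Such inequalities survive averaging over translates, so the
  heat flow never requires differentiation under the integral.\<close>

lemma psi_enlargement_eq: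
  "psi_enlargement M \<psi> \<epsilon> A = {x \<in> space M. \<exists>y\<in>A. norm (\<psi> x - \<psi> y) < \<epsilon>}"
  by (auto simp: psi_enlargement_def psi_setdist_def psi_dist_def INF_less_iff)

lemma iso_profile_distr:
  fixes \<psi> :: "'a \<Rightarrow> real ^ 'n"
  assumes \<psi>: "\<psi> \<in> measurable M borel" and g: "g \<in> measurable borel M"
    and g\<psi>: "\<And>x. x \<in> space M \<Longrightarrow> g (\<psi> x) = x" and \<psi>g: "\<And>y. \<psi> (g y) = y"
  shows "iso_profile M \<psi> = iso_profile (distr M borel \<psi>) id"
proof -
  let ?N = "distr M borel \<psi>"
  have per: "psi_perimeter M \<psi> (\<psi> -` B \<inter> space M) = psi_perimeter ?N id B"
    and meas: "measure M (\<psi> -` B \<inter> space M) = measure ?N B" if B: "B \<in> sets borel" for B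
  proof -
    \<comment> \<open>The label \<open>gauss_moment\<close> has nothing to do with the constant of
      that name defined later.\<close>
    have gauss_moment: "g y \<in> space M" for y
      using g by (auto simp: measurable_def)
    \<comment> \<open>Surjectivity enters here: a point y of B is \<open>\<psi> (g y)\<close>, hence
      the image of a point of the preimage of B.\<close>
    have enl: "psi_enlargement M \<psi> \<epsilon> (\<psi> -` B \<inter> space M) =
        \<psi> -` psi_enlargement ?N id \<epsilon> B \<inter> space M" for \<epsilon>
      unfolding psi_enlargement_eq using gauss_moment \<psi>g
      by (auto; metis vimageI IntI)
    \<comment> \<open>A union of open balls is open whatever B is, so \<open>measure_distr\<close>
      applies to the enlargement as well.\<close>
    have "psi_enlargement ?N id \<epsilon> B = (\<Union>y\<in>B. ball y \<epsilon>)" for \<epsilon>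
      by (auto simp: psi_enlargement_eq dist_norm norm_minus_commute)
    moreover have "open (\<Union>y\<in>B. ball y \<epsilon>)" for \<epsilon>
      by auto
    ultimately have "psi_enlargement ?N id \<epsilon> B \<in> sets borel" for \<epsilon>
      by (metis borel_open)
    with B enl show "psi_perimeter M \<psi> (\<psi> -` B \<inter> space M) = psi_perimeter ?N id B"
      unfolding psi_perimeter_def by (simp add: measure_distr[OF \<psi>])
    show "measure M (\<psi> -` B \<inter> space M) = measure ?N B"
      using B by (simp add: measure_distr[OF \<psi>])
  qed
  have "(\<exists>A. p = psi_perimeter M \<psi> A \<and> A \<in> sets M \<and> measure M A = v) \<longleftrightarrow>
     (\<exists>B. p = psi_perimeter ?N id B \<and> B \<in> sets ?N \<and> measure ?N B = v)" for p v
  proof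
    assume "\<exists>A. p = psi_perimeter M \<psi> A \<and> A \<in> sets M \<and> measure M A = v"
    then obtain A where A: "p = psi_perimeter M \<psi> A" "A \<in> sets M" "measure M A = v"
      by blast
    have B: "g -` A \<in> sets borel"
      using measurable_sets[OF g A(2)] by simp
    \<comment> \<open>Every measurable A is the preimage of a Borel set, so both infima range over
      the same perimeters.\<close>
    have "\<psi> -` (g -` A) \<inter> space M = A"
      using sets.sets_into_space[OF A(2)] g\<psi> by auto
    then show "\<exists>B. p = psi_perimeter ?N id B \<and> B \<in> sets ?N \<and> measure ?N B = v"
      using per[OF B] meas[OF B] A B by auto
  next
    assume "\<exists>B. p = psi_perimeter ?N id B \<and> B \<in> sets ?N \<and> measure ?N B = v"
    then show "\<exists>A. p = psi_perimeter M \<psi> A \<and> A \<in> sets M \<and> measure M A = v"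
      using per meas measurable_sets[OF \<psi>] by (metis sets_distr)
  qed
  then show ?thesis
    by (auto simp: iso_profile_def fun_eq_iff)
qed

text \<open>Open sets generate the sigma-algebra on each side, so continuity of the two maps gives
  their measurability.\<close>

lemma iso_profile_homeomorphism:
  fixes \<psi> :: "'a \<Rightarrow> real ^ 'n"
  assumes sets: "sets M = sets (borel_of X)"
    and \<psi>: "continuous_map X euclidean \<psi>" and g: "continuous_map euclidean X g"
    and g\<psi>: "\<And>x. x \<in> topspace X \<Longrightarrow> g (\<psi> x) = x" and \<psi>g: "\<And>y. \<psi> (g y) = y"
  shows "iso_profile M \<psi> = iso_profile (distr M borel \<psi>) id"
proof (rule iso_profile_distr)
  have sub: "{U. openin X U} \<subseteq> Pow (topspace X)"
    by (auto dest: openin_subset)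
  have sp: "space M = topspace X"
    using sets_eq_imp_space_eq[OF sets] by (simp add: borel_of_def space_measure_of[OF sub])
  have sM: "sets M = sigma_sets (topspace X) {U. openin X U}"
    using sets by (simp add: borel_of_def sets_measure_of[OF sub])
  show "\<psi> \<in> measurable M borel"
  proof (rule borel_measurableI)
    fix S :: "(real ^ 'n) set"
    assume "open S"
    then have "openin X {x \<in> topspace X. \<psi> x \<in> S}"
      by (intro openin_continuous_map_preimage[OF \<psi>]) simp
    moreover have "\<psi> -` S \<inter> space M = {x \<in> topspace X. \<psi> x \<in> S}"
      using sp by auto
    ultimately show "\<psi> -` S \<inter> space M \<in> sets M"
      unfolding sM by (auto intro: sigma_sets.Basic)
  qed
  show "g \<in> measurable borel M"
  proof (rule measurable_sigma_sets[OF sM sub])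
    show "g \<in> space borel \<rightarrow> topspace X"
      using g by (auto simp: continuous_map_def)
    fix U assume "U \<in> {U. openin X U}"
    then have "open (g -` U)"
      using openin_continuous_map_preimage[OF g, of U] by (simp add: vimage_def)
    then show "g -` U \<inter> space borel \<in> sets borel"
      by simp
  qed
  show "g (\<psi> x) = x" if "x \<in> space M" for x
    using that g\<psi> sp by simp
  show "\<psi> (g y) = y" for y
    by (rule \<psi>g)
qed

section \<open>The Gaussian isoperimetric function\<close>

abbreviation \<phi> :: "real \<Rightarrow> real" where "\<phi> \<equiv> std_normal_density"

lemma continuous_on_\<phi>: "continuous_on S \<phi>"
  unfolding std_normal_density_def by (intro continuous_intros) auto

lemma Phi_diff:
  assumes "a \<le> b"
  shows "Phi b - Phi a = integral {a..b} \<phi>"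
proof -
  interpret real_distribution std_normal_distribution
    by (rule real_dist_normal_dist)
  \<comment> \<open>The distribution function measures half-open intervals; the added endpoint is a
    null set.\<close>
  have "emeasure std_normal_distribution {a<..b} = emeasure std_normal_distribution {a..b}"
    by (subst (1 2) emeasure_density) (auto intro!: nn_integral_cong_AE AE_I[where N = "{a}"] split: split_indicator_asm)
  then have "Phi b - Phi a = measure std_normal_distribution {a..b}"
    using assms cdf_diff_eq[of a b] by (cases "a = b") (auto simp: Phi_def measure_def)
  also have "\<dots> = (\<integral>x\<in>{a..b}. \<phi> x \<partial>lborel)"
    by (simp add: measure_def emeasure_density set_lebesgue_integral_def integral_eq_nn_integral
        mult.commute ennreal_mult'' ennreal_indicator)
  also have "\<dots> = integral {a..b} \<phi>"
    by (rule set_borel_integral_eq_integral[OF borel_integrable_atLeastAtMost'])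
      (rule continuous_on_\<phi>)
  finally show ?thesis .
qed

lemma DERIV_Phi: "(Phi has_real_derivative \<phi> x) (at x)"
proof -
  \<comment> \<open>Fundamental theorem of calculus, with base point x - 1 so that x is interior to
    the interval.\<close>
  have "((\<lambda>u. integral {x - 1..u} \<phi>) has_real_derivative \<phi> x) (at x within {x - 1..x + 1})"
    by (rule integral_has_real_derivative) (auto intro: continuous_on_\<phi>)
  then have "((\<lambda>u. integral {x - 1..u} \<phi>) has_real_derivative \<phi> x) (at x)"
    by (subst (asm) at_within_Icc_at) auto
  then have "((\<lambda>u. Phi (x - 1) + integral {x - 1..u} \<phi>) has_real_derivative \<phi> x) (at x)"
    by (auto intro!: derivative_eq_intros)
  moreover have "eventually (\<lambda>u. Phi u = Phi (x - 1) + integral {x - 1..u} \<phi>) (nhds x)"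
    by (rule eventually_mono[OF eventually_nhds_in_open[of "{x - 1<..}" x]])
      (auto simp flip: Phi_diff)
  ultimately show ?thesis
    by (subst DERIV_cong_ev[OF refl _ refl])
qed

lemma \<phi>_pos: "0 < \<phi> x"
  by (simp add: normal_density_pos)

lemma strict_mono_Phi: "strict_mono Phi"
proof (rule strict_monoI)
  fix x y :: real
  assume "x < y"
  then show "Phi x < Phi y"
    by (rule DERIV_pos_imp_increasing[of _ _ Phi]) (use DERIV_Phi \<phi>_pos in blast)
qed

lemma Phi_less_iff [simp]: "Phi a < Phi b \<longleftrightarrow> a < b" and Phi_le_iff [simp]: "Phi a \<le> Phi b \<longleftrightarrow> a \<le> b"
  using strict_mono_Phi by (auto simp: strict_mono_less strict_mono_less_eq)

lemma isCont_Phi: "isCont Phi x"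
  using DERIV_Phi by (rule DERIV_isCont)

lemma Phi_at_top: "(Phi \<longlongrightarrow> 1) at_top" and Phi_at_bot: "(Phi \<longlongrightarrow> 0) at_bot"
proof -
  interpret real_distribution std_normal_distribution
    by (rule real_dist_normal_dist)
  show "(Phi \<longlongrightarrow> 1) at_top" "(Phi \<longlongrightarrow> 0) at_bot"
    unfolding Phi_def by (rule cdf_lim_at_top_prob cdf_lim_at_bot)+
qed

lemma Phi_bounds: "0 < Phi x" "Phi x < 1"
proof -
  interpret real_distribution std_normal_distribution
    by (rule real_dist_normal_dist)
  have "0 \<le> Phi (x - 1)" "Phi (x + 1) \<le> 1"
    by (auto simp: Phi_def cdf_nonneg cdf_bounded_prob)
  moreover have "Phi (x - 1) < Phi x" "Phi x < Phi (x + 1)"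
    by auto
  ultimately show "0 < Phi x" "Phi x < 1"
    by linarith+
qed

lemma Phi_inv:
  assumes "0 < v" "v < 1"
  shows "Phi (inv Phi v) = v"
proof -
  obtain a where a: "Phi a < v"
    using order_tendstoD(2)[OF Phi_at_bot assms(1)] by (auto simp: eventually_at_bot_linorder)
  obtain b where b: "v < Phi b"
    using order_tendstoD(1)[OF Phi_at_top assms(2)] by (auto simp: eventually_at_top_linorder)
  have "a < b"
    using a b by (metis Phi_less_iff order_less_trans)
  then have "\<exists>x\<ge>a. x \<le> b \<and> Phi x = v"
    using a b isCont_Phi by (intro IVT) auto
  then show ?thesis
    by (metis f_inv_into_f rangeI)
qed

lemma inv_Phi [simp]: "inv Phi (Phi x) = x"
  by (simp add: strict_mono_Phi strict_mono_imp_inj_on)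

lemma DERIV_inv_Phi:
  assumes "0 < v" "v < 1"
  shows "(inv Phi has_real_derivative 1 / \<phi> (inv Phi v)) (at v)"
proof -
  have "isCont (inv Phi) (Phi (inv Phi v))"
    by (rule isCont_inverse_function2[of "inv Phi v - 1" _ "inv Phi v + 1"])
      (auto simp: isCont_Phi)
  then have "isCont (inv Phi) v"
    using Phi_inv[OF assms] by simp
  then have "(inv Phi has_real_derivative inverse (\<phi> (inv Phi v))) (at v)"
    using assms Phi_inv \<phi>_pos[of "inv Phi v"]
    by (intro DERIV_inverse_function[of Phi _ _ _ 0 1] DERIV_Phi) auto
  then show ?thesis
    by (simp add: divide_inverse)
qed

text \<open>The function I. Outside (0,1) \<open>inv Phi\<close> is an arbitrary choice, so I(0) and
  I(1) are not the usual 0 but some value of \<phi>. The bounds 0 < I <= 1 nevertheless hold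
  everywhere; continuity and derivatives are claimed on (0,1) only.\<close>

definition giso :: "real \<Rightarrow> real" where
  "giso v = \<phi> (inv Phi v)"

lemma giso_Phi [simp]: "giso (Phi x) = \<phi> x"
  by (simp add: giso_def)

lemma giso_pos: "0 < giso v"
  by (simp add: giso_def \<phi>_pos)

lemma DERIV_\<phi>: "(\<phi> has_real_derivative - x * \<phi> x) (at x)"
proof -
  have eq: "\<phi> = (\<lambda>x. (1 / sqrt (2 * pi)) * exp (- x\<^sup>2 / 2))"
    by (simp add: fun_eq_iff std_normal_density_def)
  have "((\<lambda>x. - x\<^sup>2 / 2) has_real_derivative - x) (at x)"
    by (auto intro!: derivative_eq_intros)
  from DERIV_cmult[OF DERIV_fun_exp[OF this], of "1 / sqrt (2 * pi)"] show ?thesis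
    unfolding eq by (simp add: mult.commute)
qed

text \<open>With q = Phi^-1(v), the chain rule gives -q \<phi>(q) / \<phi>(q). Differentiating once
  more yields I'' = -1/I, the identity on which Bobkov's inequality rests.\<close>

lemma DERIV_giso:
  assumes "0 < v" "v < 1"
  shows "(giso has_real_derivative - inv Phi v) (at v)"
proof -
  have *: "- q * y * (1 / y) = - q" if "0 < y" for q y :: real
    using that by simp
  show ?thesis
    using DERIV_chain2[OF DERIV_\<phi> DERIV_inv_Phi[OF assms]]
    unfolding giso_def[abs_def] *[OF \<phi>_pos] .
qed

lemma isCont_giso: "0 < v \<Longrightarrow> v < 1 \<Longrightarrow> isCont giso v"
  by (rule DERIV_isCont[OF DERIV_giso])

lemma giso_le_1: "giso v \<le> 1"
proof -
  have "exp (- (inv Phi v)\<^sup>2 / 2) \<le> 1" "1 \<le> sqrt (2 * pi)"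
    using pi_gt3 by (auto simp: real_le_rsqrt)
  then have "exp (- (inv Phi v)\<^sup>2 / 2) / sqrt (2 * pi) \<le> 1"
    by (subst divide_le_eq_1_pos) linarith+
  then show ?thesis
    by (simp add: giso_def std_normal_density_def)
qed

lemma \<phi>_mono:
  assumes "\<bar>x\<bar> \<le> r"
  shows "\<phi> r \<le> \<phi> x"
proof -
  have "x\<^sup>2 \<le> r\<^sup>2"
    using assms by (metis abs_ge_zero power2_abs power_mono)
  then show ?thesis
    by (simp add: std_normal_density_def divide_right_mono)
qed

lemma inv_Phi_bounded:
  assumes "v \<in> {Phi (-r)..Phi r}"
  shows "\<bar>inv Phi v\<bar> \<le> r"
proof -
  have "0 < v" "v < 1"
    using assms Phi_bounds[of "-r"] Phi_bounds[of r] by auto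
  then have "Phi (-r) \<le> Phi (inv Phi v)" "Phi (inv Phi v) \<le> Phi r"
    using assms Phi_inv by auto
  then show ?thesis
    by auto
qed

text \<open>The positive lower bound that controls every division by I.\<close>

lemma giso_lower: "v \<in> {Phi (-r)..Phi r} \<Longrightarrow> \<phi> r \<le> giso v"
  unfolding giso_def by (intro \<phi>_mono inv_Phi_bounded)

lemma Phi_Icc_subset: "v \<in> {Phi (-r)..Phi r} \<Longrightarrow> 0 < v \<and> v < 1"
  using Phi_bounds[of "-r"] Phi_bounds[of r] by auto

text \<open>Taylor expansion of I at c with Lagrange remainder. The list \<open>diff\<close> holds
  I, I' = -Phi^-1, I'' = -1/I and I''' = -Phi^-1/I^2. On the interval the last is at most
  \<open>r / (\<phi> r)\<^sup>2\<close> in absolute value, and the factor 1/3! is given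
  away.\<close>

lemma giso_taylor:
  assumes b: "b \<in> {Phi (-r)..Phi r}" and c: "c \<in> {Phi (-r)..Phi r}"
  shows "giso c - inv Phi c * (b - c) - (b - c)\<^sup>2 / (2 * giso c) - r / (\<phi> r)\<^sup>2 * \<bar>b - c\<bar> ^ 3 \<le> giso b"
proof (cases "b = c")
  case False
  define diff :: "nat \<Rightarrow> real \<Rightarrow> real" where
    "diff m t = (if m = 0 then giso t else if m = 1 then - inv Phi t else if m = 2 then - 1 / giso t
       else - inv Phi t / (giso t)\<^sup>2)" for m t
  have deriv: "(diff m has_real_derivative diff (Suc m) t) (at t)"
    if "m < 3" "Phi (-r) \<le> t" "t \<le> Phi r" for m t
  proof -
    have t: "0 < t" "t < 1"
      using Phi_Icc_subset that by auto
    have "m = 0 \<or> m = 1 \<or> m = 2"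
      using that by auto
    then consider "m = 0" | "m = 1" | "m = 2"
      by blast
    then show ?thesis
    proof cases
      case 1
      then show ?thesis
        using DERIV_giso[OF t] by (simp add: diff_def[abs_def])
    next
      case 2
      then show ?thesis
        using DERIV_minus[OF DERIV_inv_Phi[OF t]] by (simp add: diff_def[abs_def] giso_def)
    next
      case 3
      then show ?thesis
        using giso_pos[of t]
        by (auto simp: diff_def[abs_def] power2_eq_square intro!: derivative_eq_intros DERIV_giso t)
    qed
  qed
  have "\<exists>t. (if b < c then b < t \<and> t < c else c < t \<and> t < b) \<and>
      giso b = (\<Sum>m<3. diff m c / fact m * (b - c) ^ m) + diff 3 t / fact 3 * (b - c) ^ 3"
    using b c False deriv
    by (intro Taylor[of 3 diff giso "Phi (-r)" "Phi r"]) (auto simp: diff_def[abs_def])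
  then obtain t where t: "(if b < c then b < t \<and> t < c else c < t \<and> t < b)" and
      eq: "giso b = (\<Sum>m<3. diff m c / fact m * (b - c) ^ m) + diff 3 t / fact 3 * (b - c) ^ 3"
    by blast
  have t': "t \<in> {Phi (-r)..Phi r}"
    using t b c by (auto split: if_splits)
  have sum: "(\<Sum>m<3. diff m c / fact m * (b - c) ^ m) =
      giso c - inv Phi c * (b - c) - (b - c)\<^sup>2 / (2 * giso c)"
    by (simp add: diff_def numeral_3_eq_3 power2_eq_square)
  have "\<bar>diff 3 t / fact 3 * (b - c) ^ 3\<bar> \<le> r / (\<phi> r)\<^sup>2 * \<bar>b - c\<bar> ^ 3"
  proof -
    have "\<bar>inv Phi t\<bar> / (giso t)\<^sup>2 \<le> r / (\<phi> r)\<^sup>2"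
      using inv_Phi_bounded[OF t'] giso_lower[OF t'] \<phi>_pos[of r]
      by (intro frac_le power_mono) auto
    then have "\<bar>diff 3 t / fact 3\<bar> \<le> r / (\<phi> r)\<^sup>2"
    proof -
      assume q: "\<bar>inv Phi t\<bar> / (giso t)\<^sup>2 \<le> r / (\<phi> r)\<^sup>2"
      have "\<bar>diff 3 t / fact 3\<bar> = \<bar>inv Phi t\<bar> / (giso t)\<^sup>2 / 6"
        by (simp add: diff_def abs_divide fact_numeral)
      also have "\<dots> \<le> \<bar>inv Phi t\<bar> / (giso t)\<^sup>2"
      proof -
        have *: "u / 6 \<le> u" if "0 \<le> u" for u :: real
          using that by simp
        show ?thesis
          by (rule *) simp
      qed
      finally show ?thesis
        using q by linarith
    qed
    then have "\<bar>diff 3 t / fact 3\<bar> * \<bar>b - c\<bar> ^ 3 \<le> r / (\<phi> r)\<^sup>2 * \<bar>b - c\<bar> ^ 3"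
      by (rule mult_right_mono) simp
    then show ?thesis
      by (simp add: abs_mult power_abs)
  qed
  then show ?thesis
    unfolding eq sum by linarith
qed simp

section \<open>The standard Gaussian measure\<close>

lemma std_gaussian_prod:
  "std_gaussian = density lborel (\<lambda>x :: real ^ 'n. \<Prod>b\<in>Basis. ennreal (\<phi> (x \<bullet> b)))"
proof -
  have "exp (- (norm x)\<^sup>2 / 2) / sqrt (2 * pi) ^ CARD('n) = (\<Prod>b\<in>Basis. \<phi> (x \<bullet> b))" for x :: "real ^ 'n"
  proof -
    have "(norm x)\<^sup>2 = (\<Sum>b\<in>Basis. (x \<bullet> b)\<^sup>2)"
      unfolding power2_norm_eq_inner by (subst euclidean_inner) (simp add: power2_eq_square)
    then have "- (norm x)\<^sup>2 / 2 = (\<Sum>b\<in>Basis. - (x \<bullet> b)\<^sup>2 / 2)"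
      by (simp only: sum_negf sum_divide_distrib[symmetric])
    then have "exp (- (norm x)\<^sup>2 / 2) = (\<Prod>b\<in>Basis. exp (- (x \<bullet> b)\<^sup>2 / 2))"
      by (simp only: exp_sum[OF finite_Basis])
    then show ?thesis
      by (simp add: std_normal_density_def prod_dividef)
  qed
  then show ?thesis
    unfolding std_gaussian_def by (simp add: prod_ennreal)
qed

text \<open>Source of the coordinate facts: all factors 1 gives total mass 1, one indicator gives
  the marginal laws, and two indicators give independence.\<close>

lemma nn_integral_std_gaussian_prod:
  fixes f :: "real ^ 'n \<Rightarrow> real \<Rightarrow> ennreal"
  assumes [measurable]: "\<And>b. b \<in> Basis \<Longrightarrow> f b \<in> borel_measurable borel"
  shows "(\<integral>\<^sup>+x. (\<Prod>b\<in>Basis. f b (x \<bullet> b)) \<partial>std_gaussian) =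
    (\<Prod>b\<in>Basis. \<integral>\<^sup>+y. f b y \<partial>std_normal_distribution)"
proof -
  have "(\<integral>\<^sup>+x. (\<Prod>b\<in>Basis. f b (x \<bullet> b)) \<partial>std_gaussian) =
      (\<integral>\<^sup>+x. (\<Prod>b\<in>Basis. ennreal (\<phi> (x \<bullet> b)) * f b (x \<bullet> b)) \<partial>lborel)"
    unfolding std_gaussian_prod by (subst nn_integral_density) (auto simp: prod.distrib)
  also have "\<dots> = (\<Prod>b\<in>Basis. \<integral>\<^sup>+y. ennreal (\<phi> y) * f b y \<partial>lborel)"
    by (rule nn_integral_lborel_prod) auto
  also have "\<dots> = (\<Prod>b\<in>Basis. \<integral>\<^sup>+y. f b y \<partial>std_normal_distribution)"
    by (intro prod.cong refl) (subst nn_integral_density; auto)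
  finally show ?thesis .
qed

lemma space_std_gaussian [simp]: "space std_gaussian = UNIV"
  and sets_std_gaussian [simp, measurable_cong]: "sets std_gaussian = sets borel"
  by (simp_all add: std_gaussian_def)

lemma emeasure_std_normal_UNIV: "emeasure std_normal_distribution UNIV = 1"
proof -
  interpret real_distribution std_normal_distribution
    by (rule real_dist_normal_dist)
  show ?thesis
    using emeasure_space_1 by simp
qed

lemma prob_space_std_gaussian: "prob_space (std_gaussian :: (real ^ 'n) measure)"
proof (rule prob_spaceI)
  show "emeasure (std_gaussian :: (real ^ 'n) measure) (space std_gaussian) = 1"
    using nn_integral_std_gaussian_prod[of "\<lambda>(_ :: real ^ 'n) _. 1"]
    by (simp add: emeasure_std_normal_UNIV)
qed

interpretation gauss: prob_space "std_gaussian :: (real ^ 'n) measure"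
  by (rule prob_space_std_gaussian)

lemma emeasure_std_gaussian_component:
  fixes b :: "real ^ 'n"
  assumes "b \<in> Basis" and [measurable]: "A \<in> sets borel"
  shows "emeasure std_gaussian {x. x \<bullet> b \<in> A} = emeasure std_normal_distribution A"
proof -
  define f :: "real ^ 'n \<Rightarrow> real \<Rightarrow> ennreal" where
    "f c y = (if c = b then indicator A y else 1)" for c y
  have [measurable]: "f c \<in> borel_measurable borel" for c
    unfolding f_def by measurable
  have S: "{x. x \<bullet> b \<in> A} \<in> sets std_gaussian"
    using measurable_sets[of "\<lambda>x. x \<bullet> b" borel borel A] by (simp add: vimage_def)
  have "indicator {x. x \<bullet> b \<in> A} x = (\<Prod>c\<in>Basis. f c (x \<bullet> c))" for x
    using assms(1) by (simp add: f_def prod.delta indicator_def)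
  then have "emeasure std_gaussian {x. x \<bullet> b \<in> A} = (\<integral>\<^sup>+x. (\<Prod>c\<in>Basis. f c (x \<bullet> c)) \<partial>std_gaussian)"
    using nn_integral_indicator[OF S] by simp
  also have "\<dots> = (\<Prod>c\<in>Basis. \<integral>\<^sup>+y. f c y \<partial>std_normal_distribution)"
    by (rule nn_integral_std_gaussian_prod) auto
  also have "\<dots> = (\<Prod>c\<in>Basis. if c = b then emeasure std_normal_distribution A else 1)"
    by (intro prod.cong refl) (simp add: f_def emeasure_std_normal_UNIV)
  finally show ?thesis
    using assms(1) by (simp add: prod.delta)
qed

lemma distr_std_gaussian_component:
  fixes b :: "real ^ 'n"
  assumes "b \<in> Basis"
  shows "distr std_gaussian borel (\<lambda>x. x \<bullet> b) = std_normal_distribution"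
proof (rule measure_eqI)
  fix A assume "A \<in> sets (distr std_gaussian borel (\<lambda>x. x \<bullet> b))"
  then have A: "A \<in> sets borel"
    by simp
  have "(\<lambda>x. x \<bullet> b) -` A \<inter> space std_gaussian = {x. x \<bullet> b \<in> A}"
    by auto
  then show "emeasure (distr std_gaussian borel (\<lambda>x. x \<bullet> b)) A = emeasure std_normal_distribution A"
    using A emeasure_std_gaussian_component[OF assms A] by (simp add: emeasure_distr)
qed simp

lemma indep_std_gaussian_components:
  fixes b c :: "real ^ 'n"
  assumes b: "b \<in> Basis" and c: "c \<in> Basis" and "b \<noteq> c"
  shows "gauss.indep_var borel (\<lambda>x. x \<bullet> b) borel (\<lambda>x. x \<bullet> c)"
proof -
  interpret N: real_distribution std_normal_distribution
    by (rule real_dist_normal_dist)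
  have "std_normal_distribution \<Otimes>\<^sub>M std_normal_distribution =
      distr std_gaussian (borel \<Otimes>\<^sub>M borel) (\<lambda>x. (x \<bullet> b, x \<bullet> c))"
  proof (rule pair_measure_eqI)
    fix A B assume "A \<in> sets std_normal_distribution" "B \<in> sets std_normal_distribution"
    then have [measurable]: "A \<in> sets borel" "B \<in> sets borel"
      by auto
    define f :: "real ^ 'n \<Rightarrow> real \<Rightarrow> ennreal" where
      "f d y = (if d = b then indicator A y else 1) * (if d = c then indicator B y else 1)" for d y
    have [measurable]: "f d \<in> borel_measurable borel" for d
      unfolding f_def by measurable
    have S: "{x. x \<bullet> b \<in> A \<and> x \<bullet> c \<in> B} \<in> sets std_gaussian"
      using measurable_sets[of "\<lambda>x. (x \<bullet> b, x \<bullet> c)" borel "borel \<Otimes>\<^sub>M borel" "A \<times> B"]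
      by (simp add: vimage_def)
    have "indicator {x. x \<bullet> b \<in> A \<and> x \<bullet> c \<in> B} x = (\<Prod>d\<in>Basis. f d (x \<bullet> d))" for x
      unfolding f_def prod.distrib using b c by (simp add: prod.delta indicator_def)
    then have "emeasure std_gaussian {x. x \<bullet> b \<in> A \<and> x \<bullet> c \<in> B} =
        (\<integral>\<^sup>+x. (\<Prod>d\<in>Basis. f d (x \<bullet> d)) \<partial>std_gaussian)"
      using nn_integral_indicator[OF S] by simp
    also have "\<dots> = (\<Prod>d\<in>Basis. \<integral>\<^sup>+y. f d y \<partial>std_normal_distribution)"
      by (rule nn_integral_std_gaussian_prod) auto
    also have "\<dots> = (\<Prod>d\<in>Basis. (if d = b then emeasure std_normal_distribution A else 1) *
         (if d = c then emeasure std_normal_distribution B else 1))"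
      using \<open>b \<noteq> c\<close> by (intro prod.cong refl) (simp add: f_def emeasure_std_normal_UNIV)
    also have "\<dots> = emeasure std_normal_distribution A * emeasure std_normal_distribution B"
      unfolding prod.distrib using b c by (simp add: prod.delta)
    finally show "emeasure std_normal_distribution A * emeasure std_normal_distribution B =
        emeasure (distr std_gaussian (borel \<Otimes>\<^sub>M borel) (\<lambda>x. (x \<bullet> b, x \<bullet> c))) (A \<times> B)"
      by (subst emeasure_distr) (auto simp: vimage_def)
  qed (auto intro: N.sigma_finite_measure_axioms)
  then show ?thesis
    unfolding gauss.indep_var_distribution_eq distr_std_gaussian_component[OF b]
      distr_std_gaussian_component[OF c] by simp
qed

section \<open>Moments of the coordinates and of the norm\<close>

lemma gauss_component_moment:
  fixes b :: "real ^ 'n"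
  assumes "b \<in> Basis"
  shows "integrable std_gaussian (\<lambda>x. (x \<bullet> b) ^ k)"
    and "(\<integral>x. (x \<bullet> b) ^ k \<partial>std_gaussian) = (\<integral>x. x ^ k \<partial>std_normal_distribution)"
proof -
  have "integrable (distr std_gaussian borel (\<lambda>x. x \<bullet> b)) (\<lambda>x. x ^ k)"
    unfolding distr_std_gaussian_component[OF assms] by (rule integrable_std_normal_distribution_moment)
  then show "integrable std_gaussian (\<lambda>x. (x \<bullet> b) ^ k)"
    by (subst (asm) integrable_distr_eq) auto
  show "(\<integral>x. (x \<bullet> b) ^ k \<partial>std_gaussian) = (\<integral>x. x ^ k \<partial>std_normal_distribution)"
    unfolding distr_std_gaussian_component[OF assms, symmetric] by (subst integral_distr) auto
qed

lemma gauss_covariance: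
  fixes b c :: "real ^ 'n"
  assumes b: "b \<in> Basis" and c: "c \<in> Basis"
  shows "integrable std_gaussian (\<lambda>x. (x \<bullet> b) * (x \<bullet> c))"
    and "(\<integral>x. (x \<bullet> b) * (x \<bullet> c) \<partial>std_gaussian) = (if b = c then 1 else 0)"
proof -
  have m1: "integrable std_gaussian (\<lambda>x. x \<bullet> d)" "(\<integral>x. x \<bullet> d \<partial>std_gaussian) = 0"
    if "d \<in> Basis" for d :: "real ^ 'n"
    using gauss_component_moment[OF that, of 1] integral_std_normal_distribution_moment_odd[of 1]
    by simp_all
  have m2: "integrable std_gaussian (\<lambda>x. (x \<bullet> b) * (x \<bullet> b))"
      "(\<integral>x. (x \<bullet> b) * (x \<bullet> b) \<partial>std_gaussian) = 1"
    using gauss_component_moment[OF b, of 2] std_normal_distribution_even_moments[of 1]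
    by (simp_all add: power2_eq_square)
  show "integrable std_gaussian (\<lambda>x. (x \<bullet> b) * (x \<bullet> c))"
    using m1 m2 b c gauss.indep_var_integrable[OF indep_std_gaussian_components[OF b c]]
    by (cases "b = c") auto
  show "(\<integral>x. (x \<bullet> b) * (x \<bullet> c) \<partial>std_gaussian) = (if b = c then 1 else 0)"
    using m1 m2 b c gauss.indep_var_lebesgue_integral[OF indep_std_gaussian_components[OF b c]]
    by (cases "b = c") auto
qed

text \<open>The covariance matrix is the identity, so the expansion in coordinates keeps only its
  diagonal terms.\<close>

lemma gauss_inner_square:
  fixes g :: "real ^ 'n"
  shows "integrable std_gaussian (\<lambda>x. (g \<bullet> x)\<^sup>2)"
    and "(\<integral>x. (g \<bullet> x)\<^sup>2 \<partial>std_gaussian) = (norm g)\<^sup>2"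
proof -
  have eq: "(g \<bullet> x)\<^sup>2 = (\<Sum>b\<in>Basis. \<Sum>c\<in>Basis. (g \<bullet> b) * (g \<bullet> c) * ((x \<bullet> b) * (x \<bullet> c)))"
    for x :: "real ^ 'n"
    unfolding power2_eq_square
    by (subst (1 2) euclidean_inner) (simp add: sum_product ac_simps)
  have int: "integrable std_gaussian (\<lambda>x. (g \<bullet> b) * (g \<bullet> c) * ((x \<bullet> b) * (x \<bullet> c)))"
    if "b \<in> Basis" "c \<in> Basis" for b c
    using gauss_covariance(1)[OF that] by simp
  show "integrable std_gaussian (\<lambda>x. (g \<bullet> x)\<^sup>2)"
    unfolding eq using int by (intro Bochner_Integration.integrable_sum)
  have "(\<integral>x. (g \<bullet> x)\<^sup>2 \<partial>std_gaussian) =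
      (\<Sum>b\<in>Basis. \<Sum>c\<in>Basis. \<integral>x. (g \<bullet> b) * (g \<bullet> c) * ((x \<bullet> b) * (x \<bullet> c)) \<partial>std_gaussian)"
    unfolding eq using int
    by (subst Bochner_Integration.integral_sum Bochner_Integration.integrable_sum;
        auto intro!: sum.cong Bochner_Integration.integrable_sum Bochner_Integration.integral_sum)
  also have "\<dots> = (\<Sum>b\<in>Basis. \<Sum>c\<in>Basis. (g \<bullet> b) * (g \<bullet> c) * (if b = c then 1 else 0))"
    by (intro sum.cong refl) (subst integral_mult_right_zero, subst gauss_covariance(2), auto)
  also have "\<dots> = (\<Sum>b\<in>Basis. (g \<bullet> b) * (g \<bullet> b))"
    by (intro sum.cong refl) (simp add: if_distrib[where f = "\<lambda>y. _ * y"] sum.delta' cong: if_cong)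
  also have "\<dots> = (norm g)\<^sup>2"
    by (simp add: power2_norm_eq_inner euclidean_inner[of g g])
  finally show "(\<integral>x. (g \<bullet> x)\<^sup>2 \<partial>std_gaussian) = (norm g)\<^sup>2" .
qed

text \<open>The weight (1 + |z|)^4 dominates all error terms of the one-step estimate; degree four
  comes from squaring a second-order remainder.\<close>

lemma integrable_gauss_norm4: "integrable std_gaussian (\<lambda>x :: real ^ 'n. (1 + norm x) ^ 4)"
proof (rule Bochner_Integration.integrable_bound[where
      f = "\<lambda>x :: real ^ 'n. 8 + 8 * (\<Sum>b\<in>Basis. (x \<bullet> b) ^ 4) * real CARD('n)"])
  \<comment> \<open>The constant 8 comes from applying (u + v)^2 <= 2 u^2 + 2 v^2 twice.\<close>
  have bound: "(1 + t) ^ 4 \<le> 8 + 8 * t ^ 4" for t :: real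
  proof -
    have a: "(u + v)\<^sup>2 \<le> 2 * u\<^sup>2 + 2 * v\<^sup>2" for u v :: real
      using sum_squares_bound[of u v] by (simp add: power2_sum)
    have "(1 + t) ^ 4 = ((1 + t)\<^sup>2)\<^sup>2"
      by simp
    also have "\<dots> \<le> (2 * 1\<^sup>2 + 2 * t\<^sup>2)\<^sup>2"
      by (intro power_mono a) auto
    also have "\<dots> \<le> 2 * (2 * 1\<^sup>2)\<^sup>2 + 2 * (2 * t\<^sup>2)\<^sup>2"
      by (rule a)
    finally show ?thesis
      by (simp add: power_mult_distrib)
  qed
  show "AE x :: real ^ 'n in std_gaussian. norm ((1 + norm x) ^ 4) \<le>
      norm (8 + 8 * (\<Sum>b\<in>Basis. (x \<bullet> b) ^ 4) * real CARD('n))"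
  proof (rule AE_I2)
    fix x :: "real ^ 'n"
    have "norm x ^ 4 = ((norm x)\<^sup>2)\<^sup>2"
      by simp
    also have "\<dots> = (\<Sum>b\<in>Basis. (x \<bullet> b)\<^sup>2)\<^sup>2"
      unfolding power2_norm_eq_inner by (subst euclidean_inner) (simp add: power2_eq_square)
    \<comment> \<open>Cauchy-Schwarz against the constant vector, which brings in the
      dimension.\<close>
    also have "\<dots> \<le> (\<Sum>b\<in>Basis. ((x \<bullet> b)\<^sup>2)\<^sup>2) * real (card (Basis :: (real ^ 'n) set))"
      using sum_squared_le_sum_of_squares[of "\<lambda>b. (x \<bullet> b)\<^sup>2" Basis] by simp
    finally have "norm x ^ 4 \<le> (\<Sum>b\<in>Basis. (x \<bullet> b) ^ 4) * real CARD('n)"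
      by simp
    with bound[of "norm x"]
    have "(1 + norm x) ^ 4 \<le> 8 + 8 * (\<Sum>b\<in>Basis. (x \<bullet> b) ^ 4) * real CARD('n)"
      by linarith
    then show "norm ((1 + norm x) ^ 4) \<le> norm (8 + 8 * (\<Sum>b\<in>Basis. (x \<bullet> b) ^ 4) * real CARD('n))"
      by simp
  qed
  show "integrable std_gaussian (\<lambda>x :: real ^ 'n. 8 + 8 * (\<Sum>b\<in>Basis. (x \<bullet> b) ^ 4) * real CARD('n))"
    using gauss_component_moment(1)
    by (intro Bochner_Integration.integrable_add integrable_mult_left integrable_mult_right
        Bochner_Integration.integrable_sum gauss.integrable_const) auto
qed auto

section \<open>Sum of two independent standard Gaussian vectors\<close>

lemma nn_integral_lborel_affine:
  fixes f :: "'a::euclidean_space \<Rightarrow> ennreal"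
  assumes [measurable]: "f \<in> borel_measurable borel" and "0 < c"
  shows "(\<integral>\<^sup>+x. f x \<partial>lborel) = ennreal (c ^ DIM('a)) * (\<integral>\<^sup>+x. f (t + c *\<^sub>R x) \<partial>lborel)"
  using \<open>0 < c\<close> by (subst lborel_affine[of c t])
    (simp_all add: nn_integral_density nn_integral_distr nn_integral_cmult)

text \<open>With \<open>u = z + w\<close>, completing the square gives
  \<open>\<bar>z\<bar>\<^sup>2 + \<bar>u - z\<bar>\<^sup>2 = \<bar>u\<bar>\<^sup>2 / 2 + 2 \<bar>z - u / 2\<bar>\<^sup>2\<close>.\<close>

lemma nn_integral_gauss_add:
  fixes h :: "real ^ 'n \<Rightarrow> ennreal"
  assumes [measurable]: "h \<in> borel_measurable borel"
  shows "(\<integral>\<^sup>+z. \<integral>\<^sup>+w. h (z + w) \<partial>std_gaussian \<partial>std_gaussian) =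
    (\<integral>\<^sup>+z. h (sqrt 2 *\<^sub>R z) \<partial>std_gaussian)"
proof -
  let ?n = "CARD('n)"
  define e where "e x = exp (- (norm x)\<^sup>2 / 2) / sqrt (2 * pi) ^ ?n" for x :: "real ^ 'n"
  have e0: "0 \<le> e x" for x
    by (simp add: e_def)
  have [measurable]: "e \<in> borel_measurable borel"
    unfolding e_def by measurable
  have g: "std_gaussian = density lborel (\<lambda>x. ennreal (e x))"
    by (simp add: std_gaussian_def e_def)
  have gi: "(\<integral>\<^sup>+x. k x \<partial>std_gaussian) = (\<integral>\<^sup>+x. ennreal (e x) * k x \<partial>lborel)"
    if "k \<in> borel_measurable borel" for k
    unfolding g using that by (subst nn_integral_density) auto
  have e1: "(\<integral>\<^sup>+x. ennreal (e x) \<partial>lborel) = 1"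
    using gi[of "\<lambda>_. 1"] prob_space.emeasure_space_1[OF prob_space_std_gaussian[where 'n = 'n]]
    by simp
  have square: "e z * e (u - z) = e ((1 / sqrt 2) *\<^sub>R u) * e (sqrt 2 *\<^sub>R (z - (1/2) *\<^sub>R u))" for z u
  proof -
    have "(norm z)\<^sup>2 + (norm (u - z))\<^sup>2 =
        (norm ((1 / sqrt 2) *\<^sub>R u))\<^sup>2 + (norm (sqrt 2 *\<^sub>R (z - (1/2) *\<^sub>R u)))\<^sup>2"
      unfolding norm_scaleR power_mult_distrib
      by (simp add: power2_norm_eq_inner inner_diff_left inner_diff_right inner_commute power_divide
          algebra_simps)
    then have "- (norm z)\<^sup>2 / 2 + - (norm (u - z))\<^sup>2 / 2 =
        - (norm ((1 / sqrt 2) *\<^sub>R u))\<^sup>2 / 2 + - (norm (sqrt 2 *\<^sub>R (z - (1/2) *\<^sub>R u)))\<^sup>2 / 2"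
      by argo
    then show ?thesis
      unfolding e_def times_divide_times_eq exp_add[symmetric] by simp
  qed
  have inner: "(\<integral>\<^sup>+z. ennreal (e z) * ennreal (e (u - z)) \<partial>lborel) =
      ennreal ((1 / sqrt 2) ^ ?n) * ennreal (e ((1 / sqrt 2) *\<^sub>R u))" for u
  proof -
    have "(\<integral>\<^sup>+z. ennreal (e z) * ennreal (e (u - z)) \<partial>lborel) =
        (\<integral>\<^sup>+z. ennreal (e ((1 / sqrt 2) *\<^sub>R u)) * ennreal (e (sqrt 2 *\<^sub>R (z - (1/2) *\<^sub>R u))) \<partial>lborel)"
      by (simp add: ennreal_mult[symmetric] e0 square)
    also have "\<dots> = ennreal (e ((1 / sqrt 2) *\<^sub>R u)) *
        (\<integral>\<^sup>+z. ennreal (e (sqrt 2 *\<^sub>R (z - (1/2) *\<^sub>R u))) \<partial>lborel)"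
      by (rule nn_integral_cmult) measurable
    also have "(\<integral>\<^sup>+z. ennreal (e (sqrt 2 *\<^sub>R (z - (1/2) *\<^sub>R u))) \<partial>lborel) = ennreal ((1 / sqrt 2) ^ ?n)"
      by (subst nn_integral_lborel_affine[where c = "1 / sqrt 2" and t = "(1/2) *\<^sub>R u"])
        (auto simp: e1)
    finally show ?thesis
      by (simp add: mult.commute)
  qed
  have "(\<integral>\<^sup>+z. \<integral>\<^sup>+w. h (z + w) \<partial>std_gaussian \<partial>std_gaussian) =
      (\<integral>\<^sup>+z. ennreal (e z) * (\<integral>\<^sup>+w. ennreal (e w) * h (z + w) \<partial>lborel) \<partial>lborel)"
    by (subst (1 2) gi) auto
  also have "\<dots> = (\<integral>\<^sup>+z. ennreal (e z) * (\<integral>\<^sup>+u. ennreal (e (u - z)) * h u \<partial>lborel) \<partial>lborel)"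
    using nn_integral_lborel_affine[of "\<lambda>u. ennreal (e (u - z)) * h u" 1 z for z] by simp
  also have "\<dots> = (\<integral>\<^sup>+z. \<integral>\<^sup>+u. ennreal (e z) * ennreal (e (u - z)) * h u \<partial>lborel \<partial>lborel)"
    by (intro nn_integral_cong) (subst nn_integral_cmult[symmetric], auto simp: mult.assoc)
  also have "\<dots> = (\<integral>\<^sup>+u. \<integral>\<^sup>+z. ennreal (e z) * ennreal (e (u - z)) * h u \<partial>lborel \<partial>lborel)"
    by (rule lborel_pair.Fubini') measurable
  also have "\<dots> = (\<integral>\<^sup>+u. ennreal ((1 / sqrt 2) ^ ?n) * (ennreal (e ((1 / sqrt 2) *\<^sub>R u)) * h u) \<partial>lborel)"
    by (intro nn_integral_cong) (subst nn_integral_multc, auto simp: inner mult.assoc)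
  also have "\<dots> = ennreal ((1 / sqrt 2) ^ ?n) * (\<integral>\<^sup>+u. ennreal (e ((1 / sqrt 2) *\<^sub>R u)) * h u \<partial>lborel)"
    by (rule nn_integral_cmult) measurable
  \<comment> \<open>Substituting u = sqrt 2 v: its Jacobian cancels the power of 1 / sqrt 2 left by
    the integration over z.\<close>
  also have "(\<integral>\<^sup>+u. ennreal (e ((1 / sqrt 2) *\<^sub>R u)) * h u \<partial>lborel) =
      ennreal (sqrt 2 ^ ?n) * (\<integral>\<^sup>+v. ennreal (e v) * h (sqrt 2 *\<^sub>R v) \<partial>lborel)"
    by (subst nn_integral_lborel_affine[where c = "sqrt 2" and t = 0]) auto
  also have "ennreal ((1 / sqrt 2) ^ ?n) * (ennreal (sqrt 2 ^ ?n) * (\<integral>\<^sup>+v. ennreal (e v) * h (sqrt 2 *\<^sub>R v) \<partial>lborel)) =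
      (\<integral>\<^sup>+v. h (sqrt 2 *\<^sub>R v) \<partial>std_gaussian)"
    by (subst gi) (auto simp: mult.assoc[symmetric] ennreal_mult[symmetric] power_mult_distrib[symmetric])
  finally show ?thesis .
qed

section \<open>Bobkov's inequality\<close>

text \<open>Noise of standard deviation t, that is, the semigroup of the Laplacian at time t^2/2.
  Values in a Banach space are allowed so that the same operator acts on gradients.\<close>

definition heat :: "real \<Rightarrow> (real ^ 'n \<Rightarrow> 'b::{banach, second_countable_topology}) \<Rightarrow> real ^ 'n \<Rightarrow> 'b" where
  "heat t f x = (\<integral>z. f (x + t *\<^sub>R z) \<partial>std_gaussian)"

lemma prob_std_gaussian_UNIV [simp]: "gauss.prob UNIV = 1"
  using gauss.prob_space by simp

lemma integrable_heat:
  fixes f :: "real ^ 'n \<Rightarrow> 'b::{banach, second_countable_topology}"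
  assumes "continuous_on UNIV f" and "\<And>x. norm (f x) \<le> B"
  shows "integrable std_gaussian (\<lambda>z. f (x + t *\<^sub>R z))"
proof (rule gauss.integrable_const_bound[where B = B])
  have "continuous_on UNIV (\<lambda>z. f (x + t *\<^sub>R z))"
    by (rule continuous_on_compose2[OF assms(1)]) (auto intro!: continuous_intros)
  then show "(\<lambda>z. f (x + t *\<^sub>R z)) \<in> borel_measurable std_gaussian"
    by (subst measurable_cong_sets[OF sets_std_gaussian refl]) (rule borel_measurable_continuous_onI)
qed (use assms(2) in auto)

lemma heat_mono:
  fixes f h :: "real ^ 'n \<Rightarrow> real"
  assumes "continuous_on UNIV f" "\<And>x. norm (f x) \<le> B"
    and "continuous_on UNIV h" "\<And>x. norm (h x) \<le> B'"
    and "\<And>x. f x \<le> h x"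
  shows "heat t f x \<le> heat t h x"
  unfolding heat_def using assms by (intro integral_mono integrable_heat) auto

text \<open>A constant that depends only on the dimension, which is passed as a type. The one-step
  error must not depend on f, t or x, and this is the only Gaussian quantity in it.\<close>

definition gauss_moment :: "'n::finite itself \<Rightarrow> real" where
  "gauss_moment _ = (\<integral>z. (1 + norm (z :: real ^ 'n)) ^ 4 \<partial>std_gaussian)"

lemma gauss_bound:
  fixes h :: "real ^ 'n \<Rightarrow> 'b::{banach, second_countable_topology}"
  assumes "h \<in> borel_measurable borel" and "\<And>z. norm (h z) \<le> C * (1 + norm z) ^ 4"
  shows "integrable std_gaussian h" and "norm (\<integral>z. h z \<partial>std_gaussian) \<le> C * gauss_moment TYPE('n)"
proof -
  have int: "integrable std_gaussian (\<lambda>z :: real ^ 'n. C * (1 + norm z) ^ 4)"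
    by (intro integrable_mult_right integrable_gauss_norm4)
  show h: "integrable std_gaussian h"
    by (rule Bochner_Integration.integrable_bound[OF int])
      (use assms in \<open>auto intro: order_trans[OF _ abs_ge_self]\<close>)
  have "norm (\<integral>z. h z \<partial>std_gaussian) \<le> (\<integral>z. C * (1 + norm (z :: real ^ 'n)) ^ 4 \<partial>std_gaussian)"
    by (rule Bochner_Integration.integral_norm_bound_integral[OF h int]) (rule assms(2))
  then show "norm (\<integral>z. h z \<partial>std_gaussian) \<le> C * gauss_moment TYPE('n)"
    by (simp add: gauss_moment_def)
qed

lemma gauss_moment_ge_1: "1 \<le> gauss_moment TYPE('n::finite)"
  unfolding gauss_moment_def
  by (intro gauss.integral_ge_const integrable_gauss_norm4) (auto intro!: AE_I2 one_le_power)

text \<open>The sum of two independent Gaussian vectors has the law of sqrt 2 times one of them.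
  Equality of these laws carries \<open>nn_integral_gauss_add\<close> over to integrals of signed
  functions.\<close>

lemma heat_heat:
  fixes f :: "real ^ 'n \<Rightarrow> real"
  assumes "continuous_on UNIV f" and "\<And>x. norm (f x) \<le> B"
  shows "heat t (heat t f) x = heat (sqrt 2 * t) f x"
proof -
  let ?G = "std_gaussian :: (real ^ 'n) measure"
  interpret P: pair_prob_space ?G ?G ..
  have f[measurable]: "f \<in> borel_measurable borel"
    using assms(1) by (rule borel_measurable_continuous_onI)
  have eq: "distr (?G \<Otimes>\<^sub>M ?G) borel (\<lambda>p. fst p + snd p) = distr ?G borel (\<lambda>z. sqrt 2 *\<^sub>R z)"
  proof (rule measure_eqI)
    fix A assume "A \<in> sets (distr (?G \<Otimes>\<^sub>M ?G) borel (\<lambda>p. fst p + snd p))"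
    then have [measurable]: "A \<in> sets borel"
      by simp
    have "emeasure (distr (?G \<Otimes>\<^sub>M ?G) borel (\<lambda>p. fst p + snd p)) A =
        (\<integral>\<^sup>+p. indicator A (fst p + snd p) \<partial>(?G \<Otimes>\<^sub>M ?G))"
      by (subst nn_integral_indicator[symmetric], simp) (subst nn_integral_distr, auto)
    also have "\<dots> = (\<integral>\<^sup>+z. \<integral>\<^sup>+w. indicator A (z + w) \<partial>?G \<partial>?G)"
      by (subst gauss.nn_integral_fst[symmetric]) auto
    also have "\<dots> = (\<integral>\<^sup>+z. indicator A (sqrt 2 *\<^sub>R z) \<partial>?G)"
      by (rule nn_integral_gauss_add) measurable
    also have "\<dots> = emeasure (distr ?G borel (\<lambda>z. sqrt 2 *\<^sub>R z)) A"
      by (subst nn_integral_indicator[symmetric], simp) (subst nn_integral_distr, auto)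
    finally show "emeasure (distr (?G \<Otimes>\<^sub>M ?G) borel (\<lambda>p. fst p + snd p)) A =
        emeasure (distr ?G borel (\<lambda>z. sqrt 2 *\<^sub>R z)) A" .
  qed simp
  have int: "integrable (?G \<Otimes>\<^sub>M ?G) (\<lambda>p. f (x + t *\<^sub>R (fst p + snd p)))"
    using assms(2) by (intro P.P.integrable_const_bound[where B = B]) auto
  have "heat t (heat t f) x = (\<integral>z. \<integral>w. f (x + t *\<^sub>R (z + w)) \<partial>?G \<partial>?G)"
    by (simp add: heat_def scaleR_add_right add.assoc)
  also have "\<dots> = (\<integral>p. f (x + t *\<^sub>R (fst p + snd p)) \<partial>(?G \<Otimes>\<^sub>M ?G))"
    using P.integral_fst'[OF int] by simp
  also have "\<dots> = (\<integral>y. f (x + t *\<^sub>R y) \<partial>distr (?G \<Otimes>\<^sub>M ?G) borel (\<lambda>p. fst p + snd p))"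
    by (subst integral_distr) auto
  also have "\<dots> = (\<integral>z. f (x + t *\<^sub>R sqrt 2 *\<^sub>R z) \<partial>?G)"
    unfolding eq by (subst integral_distr) auto
  finally show ?thesis
    by (simp add: heat_def mult.commute)
qed

text \<open>The function \<open>g\<close> is the gradient of \<open>f\<close>; the last bound says so without derivatives.\<close>

definition tame :: "real \<Rightarrow> real \<Rightarrow> real \<Rightarrow> (real ^ 'n \<Rightarrow> real) \<Rightarrow> (real ^ 'n \<Rightarrow> real ^ 'n) \<Rightarrow> bool" where
  "tame r L K f g \<longleftrightarrow>
     (\<forall>x. f x \<in> {Phi (-r)..Phi r}) \<and>
     (\<forall>x y. \<bar>f x - f y\<bar> \<le> L * norm (x - y)) \<and>
     (\<forall>x. norm (g x) \<le> L) \<and>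
     (\<forall>x y. norm (g x - g y) \<le> K * norm (x - y)) \<and>
     (\<forall>x u. \<bar>f (x + u) - f x - g x \<bullet> u\<bar> \<le> K * (norm u)\<^sup>2)"

lemma continuous_on_lipschitz_bound:
  fixes f :: "'a::real_normed_vector \<Rightarrow> 'b::real_normed_vector"
  assumes "\<And>x y. norm (f x - f y) \<le> L * norm (x - y)" and "0 \<le> L"
  shows "continuous_on S f"
  by (rule lipschitz_on_continuous_on[of L]) (use assms in \<open>auto intro!: lipschitz_onI simp: dist_norm\<close>)

lemma tameD:
  assumes "tame r L K f g"
  shows "f x \<in> {Phi (-r)..Phi r}" "\<bar>f x - f y\<bar> \<le> L * norm (x - y)" "norm (g x) \<le> L"
    "norm (g x - g y) \<le> K * norm (x - y)" "\<bar>f (x + u) - f x - g x \<bullet> u\<bar> \<le> K * (norm u)\<^sup>2"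
    "0 \<le> L" "0 \<le> K" "continuous_on UNIV f" "continuous_on UNIV g" "norm (f x) \<le> 1"
proof -
  show 1: "f x \<in> {Phi (-r)..Phi r}" "\<bar>f x - f y\<bar> \<le> L * norm (x - y)" "norm (g x) \<le> L"
    "norm (g x - g y) \<le> K * norm (x - y)" "\<bar>f (x + u) - f x - g x \<bullet> u\<bar> \<le> K * (norm u)\<^sup>2" for x y u
    using assms by (auto simp: tame_def)
  \<comment> \<open>A unit vector: the two Lipschitz bounds at distance 1 force L and K to be
    nonnegative.\<close>
  obtain b :: "real ^ 'a" where b: "norm b = 1"
    by (metis norm_Basis nonempty_Basis ex_in_conv)
  show LK: "0 \<le> L" "0 \<le> K"
    using 1(2)[of b 0] 1(4)[of b 0] b by (auto intro: order_trans[OF abs_ge_zero] order_trans[OF norm_ge_zero])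
  show "continuous_on UNIV f"
    by (rule continuous_on_lipschitz_bound[of _ L]) (use 1(2) LK in auto)
  show "continuous_on UNIV g"
    by (rule continuous_on_lipschitz_bound[of _ K]) (use 1(4) LK in auto)
  show "norm (f x) \<le> 1"
    using 1(1)[of x] Phi_bounds[of "-r"] Phi_bounds[of r] by auto
qed

text \<open>Each condition in \<open>tame\<close> is a convex constraint on (f, g) that is invariant
  under translation. Averaging over translates thus preserves it with the same constants, which is
  what allows the step estimate to be iterated.\<close>

lemma tame_heat:
  fixes f :: "real ^ 'n \<Rightarrow> real"
  assumes "tame r L K f g"
  shows "tame r L K (heat t f) (heat t g)"
proof -
  note D = tameD[OF assms]
  have If: "integrable std_gaussian (\<lambda>z. f (x + t *\<^sub>R z))" for x
    by (rule integrable_heat[OF D(8,10)])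
  have Ig: "integrable std_gaussian (\<lambda>z. g (x + t *\<^sub>R z))" for x
    by (rule integrable_heat[OF D(9,3)])
  have "\<bar>heat t f x - heat t f y\<bar> \<le> L * norm (x - y)" for x y
  proof -
    have "heat t f x - heat t f y = (\<integral>z. f (x + t *\<^sub>R z) - f (y + t *\<^sub>R z) \<partial>std_gaussian)"
      unfolding heat_def using If by simp
    also have "\<bar>\<dots>\<bar> \<le> (\<integral>z. L * norm (x - y) \<partial>(std_gaussian :: (real ^ 'n) measure))"
      unfolding real_norm_def[symmetric]
      by (rule Bochner_Integration.integral_norm_bound_integral)
        (use If D(2)[of "x + t *\<^sub>R z" "y + t *\<^sub>R z" for z] in auto)
    finally show ?thesis
      by simp
  qed
  moreover have "norm (heat t g x - heat t g y) \<le> K * norm (x - y)" for x y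
  proof -
    have "heat t g x - heat t g y = (\<integral>z. g (x + t *\<^sub>R z) - g (y + t *\<^sub>R z) \<partial>std_gaussian)"
      unfolding heat_def using Ig by simp
    also have "norm \<dots> \<le> (\<integral>z. K * norm (x - y) \<partial>(std_gaussian :: (real ^ 'n) measure))"
      by (rule Bochner_Integration.integral_norm_bound_integral)
        (use Ig D(4)[of "x + t *\<^sub>R z" "y + t *\<^sub>R z" for z] in auto)
    finally show ?thesis
      by simp
  qed
  moreover have "norm (heat t g x) \<le> L" for x
  proof -
    have "norm (heat t g x) \<le> (\<integral>z. L \<partial>(std_gaussian :: (real ^ 'n) measure))"
      unfolding heat_def
      by (rule Bochner_Integration.integral_norm_bound_integral) (use Ig D(3) in auto)
    then show ?thesis
      by simp
  qed
  moreover have "heat t f x \<in> {Phi (-r)..Phi r}" for x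
    unfolding heat_def atLeastAtMost_iff using D(1)
    by (intro conjI gauss.integral_ge_const gauss.integral_le_const If) auto
  moreover have "\<bar>heat t f (x + u) - heat t f x - heat t g x \<bullet> u\<bar> \<le> K * (norm u)\<^sup>2" for x u
  proof -
    have int: "integrable std_gaussian
        (\<lambda>z. f (x + u + t *\<^sub>R z) - f (x + t *\<^sub>R z) - g (x + t *\<^sub>R z) \<bullet> u)"
      using If Ig by simp
    have "heat t f (x + u) - heat t f x - heat t g x \<bullet> u =
        (\<integral>z. f (x + u + t *\<^sub>R z) - f (x + t *\<^sub>R z) - g (x + t *\<^sub>R z) \<bullet> u \<partial>std_gaussian)"
      unfolding heat_def using If Ig by simp
    also have "\<bar>\<dots>\<bar> \<le> (\<integral>z. K * (norm u)\<^sup>2 \<partial>(std_gaussian :: (real ^ 'n) measure))"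
      unfolding real_norm_def[symmetric]
      by (rule Bochner_Integration.integral_norm_bound_integral)
        (use int D(5)[of "x + t *\<^sub>R z" u for z] in \<open>auto simp: algebra_simps\<close>)
    finally show ?thesis
      by simp
  qed
  ultimately show ?thesis
    unfolding tame_def by blast
qed

section \<open>The inequality for small noise\<close>

text \<open>The integrand of Bobkov's inequality for noise of size t, by which the gradient is
  scaled; t = 1 is the usual form.\<close>

definition bobkov :: "real \<Rightarrow> (real ^ 'n \<Rightarrow> real) \<Rightarrow> (real ^ 'n \<Rightarrow> real ^ 'n) \<Rightarrow> real ^ 'n \<Rightarrow> real" where
  "bobkov t f g y = sqrt ((giso (f y))\<^sup>2 + t\<^sup>2 * (norm (g y))\<^sup>2)"

lemma continuous_on_giso_tame:
  assumes "tame r L K f g"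
  shows "continuous_on UNIV (\<lambda>y. giso (f y))"
proof -
  have "continuous_on {0<..<1} giso"
    by (intro continuous_at_imp_continuous_on) (auto intro: isCont_giso)
  then show ?thesis
    by (rule continuous_on_compose2[OF _ tameD(8)[OF assms]])
      (use Phi_Icc_subset[OF tameD(1)[OF assms]] in auto)
qed

lemma bobkov_bounds:
  assumes "tame r L K f g"
  shows "continuous_on UNIV (bobkov t f g)" "norm (bobkov t f g y) \<le> 1 + \<bar>t\<bar> * L" "0 \<le> bobkov t f g y"
proof -
  show "continuous_on UNIV (bobkov t f g)"
    unfolding bobkov_def[abs_def] using continuous_on_giso_tame[OF assms] tameD(9)[OF assms]
    by (intro continuous_intros) auto
  have "bobkov t f g y = sqrt ((giso (f y))\<^sup>2 + (t * norm (g y))\<^sup>2)"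
    by (simp add: bobkov_def power_mult_distrib)
  also have "\<dots> \<le> \<bar>giso (f y)\<bar> + \<bar>t * norm (g y)\<bar>"
    by (rule sqrt_sum_squares_le_sum_abs)
  also have "\<dots> \<le> 1 + \<bar>t\<bar> * L"
    using giso_le_1[of "f y"] giso_pos[of "f y"] tameD(3)[OF assms, of y]
    by (auto simp: abs_mult intro!: add_mono mult_left_mono)
  finally show "norm (bobkov t f g y) \<le> 1 + \<bar>t\<bar> * L"
    by (simp add: bobkov_def)
  show "0 \<le> bobkov t f g y"
    by (simp add: bobkov_def)
qed

text \<open>Cauchy-Schwarz in R x R^n for (I(f y), t g y) and (a, t v). It bounds the square root
  from below by expressions linear in I(f) and g, which can be averaged exactly.\<close>

lemma bobkov_tangent:
  "giso (f y) * a + t\<^sup>2 * (g y \<bullet> v) \<le> bobkov t f g y * sqrt (a\<^sup>2 + t\<^sup>2 * (norm v)\<^sup>2)"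
proof -
  have "(giso (f y), t *\<^sub>R g y) \<bullet> (a, t *\<^sub>R v) \<le> norm (giso (f y), t *\<^sub>R g y) * norm (a, t *\<^sub>R v)"
    by (rule norm_cauchy_schwarz)
  moreover have "(giso (f y), t *\<^sub>R g y) \<bullet> (a, t *\<^sub>R v) = giso (f y) * a + t\<^sup>2 * (g y \<bullet> v)"
    by (simp add: power2_eq_square)
  ultimately show ?thesis
    by (simp only: bobkov_def norm_Pair norm_scaleR power_mult_distrib power2_abs real_norm_def)
qed

text \<open>The increment of \<open>f\<close> over a Gaussian step of size \<open>t\<close> is compared with the linear function
  of slope \<open>heat t g x\<close> rather than \<open>g x\<close>, since this is the vector that appears when the tangent
  inequality for the square root is averaged.\<close>

lemma heat_variance:
  fixes f :: "real ^ 'n \<Rightarrow> real"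
  defines "M \<equiv> gauss_moment TYPE('n)"
  assumes "tame r L K f g" and t: "0 \<le> t" "t \<le> 1"
  shows "(\<integral>z. (f (x + t *\<^sub>R z) - heat t f x)\<^sup>2 \<partial>std_gaussian) \<le>
    t\<^sup>2 * (norm (heat t g x))\<^sup>2 + t ^ 3 * (2 * L * (K * M) + (K * M)\<^sup>2) * M"
proof -
  note D = tameD[OF assms(2)] and DH = tameD[OF tame_heat[OF assms(2)]]
  define v where "v = heat t g x"
  let ?B = "2 * L * (K * M) + (K * M)\<^sup>2"
  have M1: "1 \<le> M"
    unfolding M_def by (rule gauss_moment_ge_1)
  have [measurable]: "f \<in> borel_measurable borel" "g \<in> borel_measurable borel"
    using D(8,9) by (auto intro: borel_measurable_continuous_onI)
  have Ig: "integrable std_gaussian (\<lambda>z. g (x + t *\<^sub>R z))"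
    by (rule integrable_heat[OF D(9,3)])
  have If: "integrable std_gaussian (\<lambda>z. f (x + t *\<^sub>R z))"
    by (rule integrable_heat[OF D(8,10)])
  have w: "norm z \<le> (1 + norm z) ^ 4" for z :: "real ^ 'n"
    using power_increasing[of 1 4 "1 + norm z"] by simp
  \<comment> \<open>The averaged gradient differs from g x by O(t) since g is Lipschitz; a further
    factor t from the step makes the discrepancy O(t^2).\<close>
  have v: "norm (v - g x) \<le> K * t * M"
  proof -
    have "v - g x = (\<integral>z. g (x + t *\<^sub>R z) - g x \<partial>std_gaussian)"
      unfolding v_def heat_def using Ig by simp
    also have "norm \<dots> \<le> (K * t) * M"
      unfolding M_def
    proof (rule gauss_bound(2))
      fix z :: "real ^ 'n"
      have "norm (g (x + t *\<^sub>R z) - g x) \<le> K * (t * norm z)"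
        using D(4)[of "x + t *\<^sub>R z" x] t by simp
      also have "\<dots> \<le> (K * t) * (1 + norm z) ^ 4"
        using mult_left_mono[OF w[of z], of "K * t"] D(7) t by simp
      finally show "norm (g (x + t *\<^sub>R z) - g x) \<le> (K * t) * (1 + norm z) ^ 4" .
    qed measurable
    finally show ?thesis .
  qed
  have pointwise: "(f (x + t *\<^sub>R z) - f x)\<^sup>2 \<le> t\<^sup>2 * (v \<bullet> z)\<^sup>2 + t ^ 3 * ?B * (1 + norm z) ^ 4" for z
  proof -
    \<comment> \<open>R is the deviation from the linear function, of order t^2. Squaring leaves t^2
      (v . z)^2, a cross term of order t^3, and R^2 of order t^4, which is at most order t^3 as t <=
      1.\<close>
    define R where "R = f (x + t *\<^sub>R z) - f x - t * (v \<bullet> z)"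
    let ?w = "1 + norm z"
    have "R = (f (x + t *\<^sub>R z) - f x - g x \<bullet> (t *\<^sub>R z)) - t * ((v - g x) \<bullet> z)"
      by (simp add: R_def inner_diff_left algebra_simps)
    then have "\<bar>R\<bar> \<le> \<bar>f (x + t *\<^sub>R z) - f x - g x \<bullet> (t *\<^sub>R z)\<bar> + \<bar>t * ((v - g x) \<bullet> z)\<bar>"
      by linarith
    also have "\<dots> \<le> K * (t * norm z)\<^sup>2 + t * (K * t * M * norm z)"
    proof (rule add_mono)
      show "\<bar>f (x + t *\<^sub>R z) - f x - g x \<bullet> (t *\<^sub>R z)\<bar> \<le> K * (t * norm z)\<^sup>2"
        using D(5)[of x "t *\<^sub>R z"] t by simp
      have "\<bar>(v - g x) \<bullet> z\<bar> \<le> norm (v - g x) * norm z"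
        by (rule Cauchy_Schwarz_ineq2)
      also have "\<dots> \<le> K * t * M * norm z"
        by (intro mult_right_mono v) simp
      finally show "\<bar>t * ((v - g x) \<bullet> z)\<bar> \<le> t * (K * t * M * norm z)"
        using t by (simp add: abs_mult mult_left_mono)
    qed
    also have "\<dots> = K * t\<^sup>2 * ((norm z)\<^sup>2 + M * norm z)"
      by (simp add: power2_eq_square algebra_simps)
    also have "\<dots> \<le> K * t\<^sup>2 * (M * ?w\<^sup>2)"
    proof (rule mult_left_mono)
      have "(norm z)\<^sup>2 \<le> M * (norm z)\<^sup>2"
        using mult_right_mono[OF M1, of "(norm z)\<^sup>2"] by simp
      then show "(norm z)\<^sup>2 + M * norm z \<le> M * ?w\<^sup>2"
      proof -
        assume *: "(norm z)\<^sup>2 \<le> M * (norm z)\<^sup>2"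
        have "0 \<le> M * norm z"
          using M1 by simp
        moreover have "M * ?w\<^sup>2 = M + 2 * (M * norm z) + M * (norm z)\<^sup>2"
          by (simp add: power2_eq_square algebra_simps)
        ultimately show ?thesis
          using * M1 by linarith
      qed
    qed (use D(7) in simp)
    finally have R: "\<bar>R\<bar> \<le> K * M * t\<^sup>2 * ?w\<^sup>2"
      by (simp add: mult_ac)
    have vz: "\<bar>v \<bullet> z\<bar> \<le> L * ?w"
    proof -
      have "\<bar>v \<bullet> z\<bar> \<le> norm v * norm z"
        by (rule Cauchy_Schwarz_ineq2)
      also have "\<dots> \<le> L * ?w"
        using DH(3)[of t x] D(6) by (intro mult_mono) (auto simp: v_def)
      finally show ?thesis .
    qed
    have w34: "?w ^ 3 \<le> ?w ^ 4"
      by (rule power_increasing) auto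
    have "2 * (t * (v \<bullet> z)) * R \<le> \<bar>2 * (t * (v \<bullet> z)) * R\<bar>"
      by (rule abs_ge_self)
    also have "\<dots> = 2 * (t * \<bar>v \<bullet> z\<bar>) * \<bar>R\<bar>"
      using t by (simp add: abs_mult)
    also have "\<dots> \<le> 2 * (t * (L * ?w)) * (K * M * t\<^sup>2 * ?w\<^sup>2)"
      using t D(6) vz R by (intro mult_mono) auto
    also have "\<dots> = (t ^ 3 * (2 * L * (K * M))) * ?w ^ 3"
      by (simp add: power2_eq_square power3_eq_cube)
    also have "\<dots> \<le> (t ^ 3 * (2 * L * (K * M))) * ?w ^ 4"
      using t D(6,7) M1 by (intro mult_left_mono w34) simp
    finally have 1: "2 * (t * (v \<bullet> z)) * R \<le> (t ^ 3 * (2 * L * (K * M))) * ?w ^ 4" .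
    have "R\<^sup>2 = \<bar>R\<bar>\<^sup>2"
      by simp
    also have "\<dots> \<le> (K * M * t\<^sup>2 * ?w\<^sup>2)\<^sup>2"
      by (intro power_mono R) simp
    also have "\<dots> = t ^ 4 * ((K * M)\<^sup>2 * ?w ^ 4)"
      by (simp add: power_mult_distrib)
    also have "\<dots> \<le> t ^ 3 * ((K * M)\<^sup>2 * ?w ^ 4)"
      using t by (intro mult_right_mono power_decreasing) auto
    finally have 2: "R\<^sup>2 \<le> t ^ 3 * (K * M)\<^sup>2 * ?w ^ 4"
      by (simp add: mult.assoc)
    have "(f (x + t *\<^sub>R z) - f x)\<^sup>2 = t\<^sup>2 * (v \<bullet> z)\<^sup>2 + 2 * (t * (v \<bullet> z)) * R + R\<^sup>2"
      unfolding R_def by (simp add: power2_eq_square algebra_simps)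
    with 1 2 show ?thesis
      by (simp add: algebra_simps)
  qed
  have I2: "integrable std_gaussian (\<lambda>z. (f (x + t *\<^sub>R z) - a)\<^sup>2)" for a
  proof (rule gauss.integrable_const_bound[where B = "(1 + \<bar>a\<bar>)\<^sup>2"])
    have "\<bar>f y - a\<bar>\<^sup>2 \<le> (1 + \<bar>a\<bar>)\<^sup>2" for y
      using D(10)[of y] by (intro power_mono) auto
    then show "AE z in std_gaussian. norm ((f (x + t *\<^sub>R z) - a)\<^sup>2) \<le> (1 + \<bar>a\<bar>)\<^sup>2"
      by simp
  qed measurable
  \<comment> \<open>The second moment is smallest about the mean, so the centre may be moved to f
    x.\<close>
  have "(\<integral>z. (f (x + t *\<^sub>R z) - heat t f x)\<^sup>2 \<partial>std_gaussian) =
      (\<integral>z. (f (x + t *\<^sub>R z) - f x)\<^sup>2 + (2 * (f x - heat t f x)) * (f (x + t *\<^sub>R z) - f x)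
         + (f x - heat t f x)\<^sup>2 \<partial>std_gaussian)"
    by (intro Bochner_Integration.integral_cong refl) (simp add: power2_eq_square algebra_simps)
  also have "\<dots> = (\<integral>z. (f (x + t *\<^sub>R z) - f x)\<^sup>2 \<partial>std_gaussian)
      + (2 * (f x - heat t f x)) * (heat t f x - f x) + (f x - heat t f x)\<^sup>2"
    using I2[of "f x"] If by (simp add: heat_def)
  also have "\<dots> \<le> (\<integral>z. (f (x + t *\<^sub>R z) - f x)\<^sup>2 \<partial>std_gaussian)"
    using zero_le_power2[of "f x - heat t f x"] by (simp add: power2_eq_square algebra_simps)
  also have "\<dots> \<le> (\<integral>z. t\<^sup>2 * (v \<bullet> z)\<^sup>2 + t ^ 3 * ?B * (1 + norm z) ^ 4 \<partial>std_gaussian)"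
    using I2[of "f x"] pointwise
    by (intro integral_mono Bochner_Integration.integrable_add integrable_mult_right
        gauss_inner_square(1) integrable_gauss_norm4)
  also have "\<dots> = t\<^sup>2 * (norm v)\<^sup>2 + t ^ 3 * ?B * M"
    using gauss_inner_square[of v] integrable_gauss_norm4[where 'n = 'n]
    by (subst Bochner_Integration.integral_add) (auto simp: M_def gauss_moment_def)
  finally show ?thesis
    by (simp add: v_def)
qed

text \<open>A step moves f by at most L t |z|, and averaging moves it by at most L t M. As M >= 1,
  both fit under t L M (1 + |z|).\<close>

lemma heat_third_moment:
  fixes f :: "real ^ 'n \<Rightarrow> real"
  defines "M \<equiv> gauss_moment TYPE('n)"
  assumes "tame r L K f g" and t: "0 \<le> t" "t \<le> 1"
  shows "integrable std_gaussian (\<lambda>z. \<bar>f (x + t *\<^sub>R z) - heat t f x\<bar> ^ 3)"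
    and "(\<integral>z. \<bar>f (x + t *\<^sub>R z) - heat t f x\<bar> ^ 3 \<partial>std_gaussian) \<le> t ^ 3 * (L * M) ^ 3 * M"
proof -
  note D = tameD[OF assms(2)]
  have M1: "1 \<le> M"
    unfolding M_def by (rule gauss_moment_ge_1)
  have [measurable]: "f \<in> borel_measurable borel"
    using D(8) by (auto intro: borel_measurable_continuous_onI)
  have If: "integrable std_gaussian (\<lambda>z. f (x + t *\<^sub>R z))"
    by (rule integrable_heat[OF D(8,10)])
  have incr: "\<bar>f (x + t *\<^sub>R z) - f x\<bar> \<le> L * t * norm z" for z
    using D(2)[of "x + t *\<^sub>R z" x] t by (simp add: mult.assoc)
  have w: "norm z \<le> (1 + norm z) ^ 4" for z :: "real ^ 'n"
    using power_increasing[of 1 4 "1 + norm z"] by simp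
  have mean: "\<bar>heat t f x - f x\<bar> \<le> L * t * M"
  proof -
    have "heat t f x - f x = (\<integral>z. f (x + t *\<^sub>R z) - f x \<partial>std_gaussian)"
      unfolding heat_def using If by simp
    also have "norm \<dots> \<le> (L * t) * M"
      unfolding M_def
    proof (rule gauss_bound(2))
      show "norm (f (x + t *\<^sub>R z) - f x) \<le> (L * t) * (1 + norm z) ^ 4" for z
        using order_trans[OF incr mult_left_mono[OF w[of z], of "L * t"]] D(6) t by simp
    qed measurable
    finally show ?thesis
      by simp
  qed
  have bound: "norm (\<bar>f (x + t *\<^sub>R z) - heat t f x\<bar> ^ 3) \<le> (t ^ 3 * (L * M) ^ 3) * (1 + norm z) ^ 4" for z
  proof -
    have "\<bar>f (x + t *\<^sub>R z) - heat t f x\<bar> \<le> L * t * norm z + L * t * M"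
      using incr[of z] mean by linarith
    also have "\<dots> \<le> t * (L * M) * (1 + norm z)"
    proof -
      have "norm z \<le> M * norm z"
        using mult_right_mono[OF M1, of "norm z"] by simp
      then have "(L * t) * (norm z + M) \<le> (L * t) * (M * (1 + norm z))"
        using D(6) t by (intro mult_left_mono) (auto simp: algebra_simps)
      then show ?thesis
        by (simp add: algebra_simps)
    qed
    finally have "\<bar>f (x + t *\<^sub>R z) - heat t f x\<bar> ^ 3 \<le> (t * (L * M) * (1 + norm z)) ^ 3"
      by (intro power_mono) auto
    also have "\<dots> = (t ^ 3 * (L * M) ^ 3) * (1 + norm z) ^ 3"
      by (simp add: power_mult_distrib)
    also have "\<dots> \<le> (t ^ 3 * (L * M) ^ 3) * (1 + norm z) ^ 4"
      using t D(6) M1 by (intro mult_left_mono power_increasing) auto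
    finally show ?thesis
      by simp
  qed
  show "integrable std_gaussian (\<lambda>z. \<bar>f (x + t *\<^sub>R z) - heat t f x\<bar> ^ 3)"
    by (rule gauss_bound(1)[OF _ bound]) measurable
  have "norm (\<integral>z. \<bar>f (x + t *\<^sub>R z) - heat t f x\<bar> ^ 3 \<partial>std_gaussian) \<le> (t ^ 3 * (L * M) ^ 3) * M"
    unfolding M_def[symmetric] using gauss_bound(2)[OF _ bound] by (simp add: M_def)
  then show "(\<integral>z. \<bar>f (x + t *\<^sub>R z) - heat t f x\<bar> ^ 3 \<partial>std_gaussian) \<le> t ^ 3 * (L * M) ^ 3 * M"
    by simp
qed

text \<open>Let A = I(c) at the mean c of f under the noise, v the averaged gradient and N = sqrt
  (A^2 + t^2 |v|^2). Taylor bounds the mean F of I(f) below by A - t^2 |v|^2 / (2 A) - O(t^3). The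
  averaged tangent inequality is F A + t^2 |v|^2 <= E N. Together they give E N >= A^2 + t^2 |v|^2 /
  2 - O(t^3), and the main part is at least A N. The constant precedes f, g, t and x because the
  iteration needs it uniform.\<close>

lemma bobkov_step:
  obtains C where "0 \<le> C" and "\<And>(f :: real ^ 'n \<Rightarrow> real) g t x. tame r L K f g \<Longrightarrow> 0 \<le> t \<Longrightarrow> t \<le> 1 \<Longrightarrow>
    giso (heat t f x) \<le> heat t (bobkov t f g) x + C * t ^ 3"
proof -
  define M where "M = gauss_moment TYPE('n)"
  \<comment> \<open>Absolute values keep the constants nonnegative for arbitrary real r, L and K,
    before any tame function is at hand.\<close>
  define C1 where "C1 = \<bar>(2 * L * (K * M) + (K * M)\<^sup>2) * M\<bar>"
  define C2 where "C2 = \<bar>r / (\<phi> r)\<^sup>2\<bar> * \<bar>(L * M) ^ 3 * M\<bar>"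
  \<comment> \<open>The final inequality is divided by N, and N >= A >= \<phi> r.\<close>
  define C where "C = (C1 / 2 + C2) / \<phi> r"
  show thesis
  proof (rule that)
    show C: "0 \<le> C"
      using \<phi>_pos[of r] by (simp add: C_def C1_def C2_def)
    fix f :: "real ^ 'n \<Rightarrow> real" and g and t :: real and x
    assume tame: "tame r L K f g" and t: "0 \<le> t" "t \<le> 1"
    note D = tameD[OF tame] and DH = tameD[OF tame_heat[OF tame]]
    define c where "c = heat t f x"
    define v where "v = heat t g x"
    define A where "A = giso c"
    define N where "N = sqrt (A\<^sup>2 + t\<^sup>2 * (norm v)\<^sup>2)"
    define E where "E = heat t (bobkov t f g) x"
    define V where "V = (\<integral>z. (f (x + t *\<^sub>R z) - c)\<^sup>2 \<partial>std_gaussian)"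
    define T where "T = (\<integral>z. \<bar>f (x + t *\<^sub>R z) - c\<bar> ^ 3 \<partial>std_gaussian)"
    define F where "F = (\<integral>z. giso (f (x + t *\<^sub>R z)) \<partial>std_gaussian)"
    let ?R = "r / (\<phi> r)\<^sup>2"
    \<comment> \<open>Any single value of f lies in [Phi(-r), Phi r], so r bounds an absolute
      value.\<close>
    have r: "0 \<le> r"
      using inv_Phi_bounded[OF D(1)[of x]] by linarith
    then have R0: "0 \<le> ?R"
      by (rule divide_nonneg_nonneg) simp
    have [measurable]: "f \<in> borel_measurable borel"
      using D(8) by (auto intro: borel_measurable_continuous_onI)
    have c_range: "c \<in> {Phi (-r)..Phi r}"
      unfolding c_def by (rule DH(1))
    have A: "0 < A" "A \<le> 1" "\<phi> r \<le> A"
      using giso_pos giso_le_1 giso_lower[OF c_range] by (auto simp: A_def)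
    have If: "integrable std_gaussian (\<lambda>z. f (x + t *\<^sub>R z))"
      by (rule integrable_heat[OF D(8,10)])
    have Ig: "integrable std_gaussian (\<lambda>z. g (x + t *\<^sub>R z))"
      by (rule integrable_heat[OF D(9,3)])
    have Igi: "integrable std_gaussian (\<lambda>z. giso (f (x + t *\<^sub>R z)))"
      by (rule integrable_heat[OF continuous_on_giso_tame[OF tame], of 1])
        (use giso_pos giso_le_1 in \<open>auto simp: abs_of_pos\<close>)
    have Ib: "integrable std_gaussian (\<lambda>z. bobkov t f g (x + t *\<^sub>R z))"
      by (rule integrable_heat[OF bobkov_bounds(1,2)[OF tame]])
    have I2: "integrable std_gaussian (\<lambda>z. (f (x + t *\<^sub>R z) - c)\<^sup>2)"
    proof (rule gauss.integrable_const_bound[where B = "(1 + \<bar>c\<bar>)\<^sup>2"])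
      have "\<bar>f y - c\<bar>\<^sup>2 \<le> (1 + \<bar>c\<bar>)\<^sup>2" for y
        using D(10)[of y] by (intro power_mono) auto
      then show "AE z in std_gaussian. norm ((f (x + t *\<^sub>R z) - c)\<^sup>2) \<le> (1 + \<bar>c\<bar>)\<^sup>2"
        by simp
    qed measurable
    have I3: "integrable std_gaussian (\<lambda>z. \<bar>f (x + t *\<^sub>R z) - c\<bar> ^ 3)"
      unfolding c_def by (rule heat_third_moment(1)[OF tame t])
    have V: "V \<le> t\<^sup>2 * (norm v)\<^sup>2 + C1 * t ^ 3"
    proof -
      have "t ^ 3 * ((2 * L * (K * M) + (K * M)\<^sup>2) * M) \<le> t ^ 3 * C1"
        using t unfolding C1_def by (intro mult_left_mono abs_ge_self) simp
      then show ?thesis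
        using heat_variance[OF tame t, of x] by (simp add: V_def c_def v_def M_def mult_ac)
    qed
    have T: "?R * T \<le> C2 * t ^ 3"
    proof -
      have "T \<le> t ^ 3 * (L * M) ^ 3 * M"
        unfolding T_def c_def M_def by (rule heat_third_moment(2)[OF tame t])
      also have "\<dots> = t ^ 3 * ((L * M) ^ 3 * M)"
        by simp
      also have "\<dots> \<le> t ^ 3 * \<bar>(L * M) ^ 3 * M\<bar>"
        using t by (intro mult_left_mono abs_ge_self) simp
      finally have "?R * T \<le> ?R * (t ^ 3 * \<bar>(L * M) ^ 3 * M\<bar>)"
        using R0 by (rule mult_left_mono)
      then show ?thesis
        unfolding C2_def abs_of_nonneg[OF R0] by (simp only: mult_ac)
    qed
    \<comment> \<open>The linear Taylor term integrates to 0 because c is the mean.\<close>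
    have "A - V / (2 * A) - ?R * T =
        (\<integral>z. A - inv Phi c * (f (x + t *\<^sub>R z) - c) - (f (x + t *\<^sub>R z) - c)\<^sup>2 / (2 * A)
          - ?R * \<bar>f (x + t *\<^sub>R z) - c\<bar> ^ 3 \<partial>std_gaussian)"
      using If I2 I3 by (simp add: V_def T_def c_def heat_def)
    also have "\<dots> \<le> F"
      unfolding F_def using If I2 I3 Igi giso_taylor[OF D(1) c_range]
      by (intro integral_mono) (auto simp: A_def)
    finally have F: "A - V / (2 * A) - ?R * T \<le> F" .
    have "F * A + t\<^sup>2 * (norm v)\<^sup>2 =
        (\<integral>z. giso (f (x + t *\<^sub>R z)) * A + t\<^sup>2 * (g (x + t *\<^sub>R z) \<bullet> v) \<partial>std_gaussian)"
      using Igi Ig by (simp add: F_def v_def heat_def power2_norm_eq_inner)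
    also have "\<dots> \<le> (\<integral>z. bobkov t f g (x + t *\<^sub>R z) * N \<partial>std_gaussian)"
      using Igi Ig Ib by (intro integral_mono) (auto simp: N_def bobkov_tangent)
    also have "\<dots> = E * N"
      by (simp add: E_def heat_def)
    finally have EN: "F * A + t\<^sup>2 * (norm v)\<^sup>2 \<le> E * N" .
    have "A\<^sup>2 - V / 2 - C2 * t ^ 3 \<le> (A - V / (2 * A) - ?R * T) * A"
    proof -
      have "?R * T * A \<le> C2 * t ^ 3 * A"
        using T A by (intro mult_right_mono) auto
      also have "\<dots> \<le> C2 * t ^ 3 * 1"
        using A t by (intro mult_left_mono) (auto simp: C2_def)
      finally have "?R * T * A \<le> C2 * t ^ 3"
        by simp
      moreover have "(A - V / (2 * A) - ?R * T) * A = A\<^sup>2 - V / 2 - ?R * T * A"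
        using A by (simp add: field_simps power2_eq_square)
      ultimately show ?thesis
        by simp
    qed
    also have "\<dots> \<le> F * A"
      using F A by (intro mult_right_mono) auto
    finally have 1: "A\<^sup>2 + t\<^sup>2 * (norm v)\<^sup>2 / 2 - (C1 / 2 + C2) * t ^ 3 \<le> E * N"
      using EN V by (simp add: algebra_simps)
    have N: "0 < N" "A \<le> N"
      using A by (auto simp: N_def intro!: real_sqrt_gt_zero add_pos_nonneg real_le_rsqrt)
    \<comment> \<open>AM-GM for A and N; here the terms of order t^2 match.\<close>
    have "A * N \<le> A\<^sup>2 + t\<^sup>2 * (norm v)\<^sup>2 / 2"
    proof -
      have "A * N \<le> (A\<^sup>2 + N\<^sup>2) / 2"
        using sum_squares_bound[of A N] by simp
      also have "N\<^sup>2 = A\<^sup>2 + t\<^sup>2 * (norm v)\<^sup>2"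
        by (simp add: N_def)
      finally show ?thesis
        by simp
    qed
    with 1 have "A * N \<le> E * N + (C1 / 2 + C2) * t ^ 3"
      by linarith
    also have "(C1 / 2 + C2) * t ^ 3 = C * t ^ 3 * \<phi> r"
      using \<phi>_pos[of r] by (simp add: C_def)
    also have "\<dots> \<le> C * t ^ 3 * N"
      using C t A N by (intro mult_left_mono) auto
    finally have "A * N \<le> (E + C * t ^ 3) * N"
      by (simp add: distrib_right)
    then have "A \<le> E + C * t ^ 3"
      using N by simp
    then show "giso (heat t f x) \<le> heat t (bobkov t f g) x + C * t ^ 3"
      by (simp add: A_def c_def E_def)
  qed
qed

text \<open>Noise of size sqrt 2 t is two steps of size t. The outer step uses the hypothesis for
  the pair (heat t f, heat t g), the inner one for (f, g), and each contributes \<delta>.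
  Minkowski's inequality merges the gradients: t^2 |g|^2 from either step adds up to (sqrt 2 t)^2
  |g|^2.\<close>

lemma bobkov_doubling:
  fixes \<delta> :: real
  assumes step: "\<And>(f :: real ^ 'n \<Rightarrow> real) g x. tame r L K f g \<Longrightarrow>
      giso (heat t f x) \<le> heat t (bobkov t f g) x + \<delta>"
    and \<delta>: "0 \<le> \<delta>" and t: "0 \<le> t" and tame: "tame r L K (f :: real ^ 'n \<Rightarrow> real) g"
  shows "giso (heat (sqrt 2 * t) f x) \<le> heat (sqrt 2 * t) (bobkov (sqrt 2 * t) f g) x + 2 * \<delta>"
proof -
  note D = tameD[OF tame] and B = bobkov_bounds[OF tame] and BH = bobkov_bounds[OF tame_heat[OF tame]]
  let ?S = "bobkov (sqrt 2 * t) f g"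
  \<comment> \<open>Needed because \<open>heat t ?S\<close> is itself put under a second Gaussian
    integral; dominated convergence with a constant bound.\<close>
  have contH: "continuous_on UNIV (\<lambda>y. heat t ?S y)"
  proof -
    have [measurable]: "?S \<in> borel_measurable borel"
      by (rule borel_measurable_continuous_onI[OF B(1)])
    show ?thesis
      unfolding continuous_on_sequentially
    proof (intro ballI allI impI)
      fix u :: "nat \<Rightarrow> real ^ 'n" and a
      assume "(\<forall>n. u n \<in> UNIV) \<and> u \<longlonglongrightarrow> a"
      then have u: "u \<longlonglongrightarrow> a"
        by simp
      show "((\<lambda>y. heat t ?S y) \<circ> u) \<longlonglongrightarrow> heat t ?S a"
        unfolding heat_def o_def
      proof (rule integral_dominated_convergence[where w = "\<lambda>_. 1 + \<bar>sqrt 2 * t\<bar> * L"])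
        show "AE z in std_gaussian. (\<lambda>n. ?S (u n + t *\<^sub>R z)) \<longlonglongrightarrow> ?S (a + t *\<^sub>R z)"
        proof (rule AE_I2)
          fix z
          have "isCont ?S (a + t *\<^sub>R z)"
            using B(1) by (simp add: continuous_on_eq_continuous_at)
          moreover have "(\<lambda>n. u n + t *\<^sub>R z) \<longlonglongrightarrow> a + t *\<^sub>R z"
            by (intro tendsto_intros u)
          ultimately show "(\<lambda>n. ?S (u n + t *\<^sub>R z)) \<longlonglongrightarrow> ?S (a + t *\<^sub>R z)"
            by (rule isCont_tendsto_compose)
        qed
        show "AE z in std_gaussian. norm (?S (u n + t *\<^sub>R z)) \<le> 1 + \<bar>sqrt 2 * t\<bar> * L" for n
          by (rule AE_I2) (rule B(2))
      qed simp_all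
    qed
  qed
  have boundH: "norm (heat t ?S y) \<le> 1 + \<bar>sqrt 2 * t\<bar> * L" for y
  proof -
    have "norm (heat t ?S y) \<le> (\<integral>z. 1 + \<bar>sqrt 2 * t\<bar> * L \<partial>(std_gaussian :: (real ^ 'n) measure))"
      unfolding heat_def
      by (rule Bochner_Integration.integral_norm_bound_integral[OF integrable_heat[OF B(1,2)]])
        (use B(2) in auto)
    then show ?thesis
      by simp
  qed
  have pointwise: "bobkov t (heat t f) (heat t g) y \<le> heat t ?S y + \<delta>" for y
  proof -
    define a where "a = heat t (bobkov t f g) y"
    define b where "b = heat t (\<lambda>y. t * norm (g y)) y"
    have Ib: "integrable std_gaussian (\<lambda>z. bobkov t f g (y + t *\<^sub>R z))"
      by (rule integrable_heat[OF B(1,2)])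
    have Ig: "integrable std_gaussian (\<lambda>z. g (y + t *\<^sub>R z))"
      by (rule integrable_heat[OF D(9,3)])
    have "norm (heat t g y) \<le> (\<integral>z. norm (g (y + t *\<^sub>R z)) \<partial>std_gaussian)"
      unfolding heat_def by (rule integral_norm_bound)
    then have b: "t * norm (heat t g y) \<le> b"
      using t by (simp add: b_def heat_def mult_left_mono)
    have "bobkov t (heat t f) (heat t g) y = sqrt ((giso (heat t f y))\<^sup>2 + (t * norm (heat t g y))\<^sup>2)"
      by (simp add: bobkov_def power_mult_distrib)
    also have "\<dots> \<le> sqrt ((a + \<delta>)\<^sup>2 + b\<^sup>2)"
      using step[OF tame, of y] b t giso_pos[of "heat t f y"]
      by (intro real_sqrt_le_mono add_mono power_mono) (auto simp: a_def)
    also have "\<dots> \<le> sqrt (a\<^sup>2 + b\<^sup>2) + \<delta>"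
      using real_sqrt_sum_squares_triangle_ineq[of a \<delta> b 0] \<delta> by simp
    also have "sqrt (a\<^sup>2 + b\<^sup>2) \<le> heat t ?S y"
    proof -
      \<comment> \<open>The pair of integrands is read as one complex function, so that Minkowski's
        inequality is the bound of the norm of an integral by the integral of the norm.\<close>
      let ?h = "\<lambda>z. complex_of_real (bobkov t f g (y + t *\<^sub>R z))
          + \<i> * complex_of_real (t * norm (g (y + t *\<^sub>R z)))"
      have Ig': "integrable std_gaussian (\<lambda>z. t * norm (g (y + t *\<^sub>R z)))"
        using Ig by (intro integrable_mult_right integrable_norm)
      have "(\<integral>z. ?h z \<partial>std_gaussian) = (\<integral>z. complex_of_real (bobkov t f g (y + t *\<^sub>R z)) \<partial>std_gaussian)
          + (\<integral>z. \<i> * complex_of_real (t * norm (g (y + t *\<^sub>R z))) \<partial>std_gaussian)"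
        by (rule Bochner_Integration.integral_add[OF integrable_of_real[OF Ib]
              integrable_mult_right[OF integrable_of_real[OF Ig']]])
      also have "\<dots> = complex_of_real a + \<i> * complex_of_real b"
        unfolding a_def b_def heat_def integral_mult_right_zero integral_complex_of_real ..
      finally have "sqrt (a\<^sup>2 + b\<^sup>2) = norm (\<integral>z. ?h z \<partial>std_gaussian)"
        by (simp add: cmod_def)
      also have "\<dots> \<le> (\<integral>z. norm (?h z) \<partial>std_gaussian)"
        by (rule integral_norm_bound)
      also have "\<dots> = heat t ?S y"
        unfolding heat_def
        by (intro Bochner_Integration.integral_cong refl)
          (simp add: cmod_def bobkov_def power_mult_distrib)
      finally show ?thesis .
    qed
    finally show ?thesis
      by simp
  qed
  have "giso (heat (sqrt 2 * t) f x) = giso (heat t (heat t f) x)"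
    using heat_heat[OF D(8,10)] by simp
  also have "\<dots> \<le> heat t (bobkov t (heat t f) (heat t g)) x + \<delta>"
    by (rule step[OF tame_heat[OF tame]])
  also have "heat t (bobkov t (heat t f) (heat t g)) x \<le> heat t (\<lambda>y. heat t ?S y + \<delta>) x"
  proof (rule heat_mono[OF BH(1,2) _ _ pointwise])
    show "continuous_on UNIV (\<lambda>y. heat t ?S y + \<delta>)"
      by (intro continuous_intros contH)
    show "norm (heat t ?S y + \<delta>) \<le> (1 + \<bar>sqrt 2 * t\<bar> * L) + \<delta>" for y
      using boundH[of y] \<delta> by simp
  qed
  also have "heat t (\<lambda>y. heat t ?S y + \<delta>) x = heat t (heat t ?S) x + \<delta>"
    using integrable_heat[OF contH boundH, of x t] by (simp add: heat_def[of t "\<lambda>y. heat t ?S y + \<delta>"] heat_def[of t "heat t ?S"])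
  also have "heat t (heat t ?S) x = heat (sqrt 2 * t) ?S x"
    by (rule heat_heat[OF B(1,2)])
  finally show ?thesis
    by simp
qed

theorem bobkov_inequality:
  fixes f :: "real ^ 'n \<Rightarrow> real"
  assumes tame: "tame r L K f g"
  shows "giso (\<integral>z. f z \<partial>std_gaussian) \<le> (\<integral>z. sqrt ((giso (f z))\<^sup>2 + (norm (g z))\<^sup>2) \<partial>std_gaussian)"
proof -
  obtain C where C: "0 \<le> C" and step: "\<And>(f :: real ^ 'n \<Rightarrow> real) g t x. tame r L K f g \<Longrightarrow>
      0 \<le> t \<Longrightarrow> t \<le> 1 \<Longrightarrow> giso (heat t f x) \<le> heat t (bobkov t f g) x + C * t ^ 3"
    using bobkov_step by blast
  \<comment> \<open>The induction runs over all tame pairs at once, since doubling applies the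
    previous stage to the smoothed pair.\<close>
  have iterate: "giso (heat (sqrt 2 ^ k * t) f x) \<le> heat (sqrt 2 ^ k * t) (bobkov (sqrt 2 ^ k * t) f g) x
      + 2 ^ k * (C * t ^ 3)"
    if "0 \<le> t" "t \<le> 1" "tame r L K f g" for k t x and f :: "real ^ 'n \<Rightarrow> real" and g
    using that(3)
  proof (induction k arbitrary: f g x)
    case 0
    then show ?case
      using step that by simp
  next
    case (Suc k)
    show ?case
      using bobkov_doubling[of r L K "sqrt 2 ^ k * t" "2 ^ k * (C * t ^ 3)" f g x] Suc C that
      by (simp add: mult.assoc)
  qed
  \<comment> \<open>At size 1 and base point 0, \<open>heat\<close> is the Gaussian mean.\<close>
  have "giso (heat 1 f 0) \<le> heat 1 (bobkov 1 f g) 0 + C * (1 / sqrt 2) ^ k" for k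
  proof -
    have t: "0 \<le> (1 / sqrt 2) ^ k" "(1 / sqrt 2) ^ k \<le> (1 :: real)"
      by (auto intro!: power_le_one)
    have s: "sqrt 2 ^ k * (1 / sqrt 2) ^ k = 1"
      by (simp add: power_mult_distrib[symmetric])
    have eq: "2 ^ k * (C * ((1 / sqrt 2) ^ k) ^ 3) = C * (1 / sqrt 2) ^ k"
    proof -
      have "2 ^ k * (C * ((1 / sqrt 2) ^ k) ^ 3) = C * (2 * (1 / sqrt 2) ^ 3) ^ k"
      by (simp add: power_mult_distrib power_mult[symmetric] mult.commute)
    also have "2 * (1 / sqrt 2) ^ 3 = 1 / sqrt 2"
      by (simp add: power3_eq_cube field_simps)
    finally show ?thesis .
    qed
    show ?thesis
      using iterate[OF t tame, of k 0] unfolding s eq .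
  qed
  moreover have "(\<lambda>k. heat 1 (bobkov 1 f g) 0 + C * (1 / sqrt 2) ^ k) \<longlonglongrightarrow> heat 1 (bobkov 1 f g) 0 + C * 0"
    by (intro tendsto_intros LIMSEQ_power_zero) simp
  ultimately have "giso (heat 1 f 0) \<le> heat 1 (bobkov 1 f g) 0 + C * 0"
    by (intro LIMSEQ_le_const) auto
  then show ?thesis
    by (simp add: heat_def bobkov_def)
qed

section \<open>Mollification\<close>

lemma le_of_small_perturbation:
  fixes a b c d :: real
  assumes "0 < d" and "\<And>h. 0 < h \<Longrightarrow> h \<le> d \<Longrightarrow> a \<le> b + c * h"
  shows "a \<le> b"
proof (rule tendsto_lowerbound)
  show "((\<lambda>h. b + c * h) \<longlongrightarrow> b) (at_right 0)"
    by (auto intro!: tendsto_eq_intros)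
  show "eventually (\<lambda>h. a \<le> b + c * h) (at_right 0)"
    unfolding eventually_at_right_field using assms by (intro exI[of _ d]) auto
qed simp

text \<open>Keeps test increments h v in the unit ball, where expansions are assumed; the 1 in the
  denominator covers v = 0.\<close>

lemma small_multiple:
  fixes v :: "'a::real_normed_vector"
  obtains d where "0 < d" and "\<And>h. 0 < h \<Longrightarrow> h \<le> d \<Longrightarrow> norm (h *\<^sub>R v) \<le> 1"
proof (rule that[of "1 / (1 + norm v)"])
  show "0 < 1 / (1 + norm v)"
    by (simp add: add_pos_nonneg)
  fix h :: real
  assume h: "0 < h" "h \<le> 1 / (1 + norm v)"
  have "h * norm v \<le> 1 / (1 + norm v) * norm v"
    using h by (intro mult_right_mono) auto
  also have "\<dots> \<le> 1"
    by (simp add: add_pos_nonneg)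
  finally show "norm (h *\<^sub>R v) \<le> 1"
    using h by simp
qed

text \<open>Test the expansion with u = h v, divide by h |v| and let h tend to 0.\<close>

lemma gradient_norm_le:
  fixes f :: "'a::real_inner \<Rightarrow> real"
  assumes expand: "\<And>u. norm u \<le> 1 \<Longrightarrow> \<bar>f (x + u) - f x - v \<bullet> u\<bar> \<le> K * (norm u)\<^sup>2"
    and lip: "\<And>y. \<bar>f y - f x\<bar> \<le> L * norm (y - x)"
    and L: "0 \<le> L"
  shows "norm v \<le> L"
proof (cases "v = 0")
  case True
  then show ?thesis
    using L by simp
next
  case False
  obtain d where d: "0 < d" "\<And>h. 0 < h \<Longrightarrow> h \<le> d \<Longrightarrow> norm (h *\<^sub>R v) \<le> 1"
    using small_multiple[of v] by blast
  show ?thesis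
  proof (rule le_of_small_perturbation[OF d(1)])
    fix h :: real
    assume h: "0 < h" "h \<le> d"
    have "\<bar>f (x + h *\<^sub>R v) - f x - v \<bullet> (h *\<^sub>R v)\<bar> \<le> K * (norm (h *\<^sub>R v))\<^sup>2"
      by (intro expand d(2) h)
    moreover have "\<bar>f (x + h *\<^sub>R v) - f x\<bar> \<le> L * norm (h *\<^sub>R v)"
      using lip[of "x + h *\<^sub>R v"] by simp
    ultimately have "v \<bullet> (h *\<^sub>R v) \<le> L * norm (h *\<^sub>R v) + K * (norm (h *\<^sub>R v))\<^sup>2"
      by linarith
    then have "(h * norm v) * norm v \<le> (h * norm v) * (L + K * norm v * h)"
      using h by (simp add: power2_norm_eq_inner[symmetric] power2_eq_square algebra_simps)
    then show "norm v \<le> L + K * norm v * h"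
      using h False by simp
  qed
qed

text \<open>Test with h v at a maximum and -h v at a minimum, then let h tend to 0. This makes the
  gradient of the plateau function vanish wherever its value is 1 or 0.\<close>

lemma gradient_eq_0:
  fixes f :: "'a::real_inner \<Rightarrow> real"
  assumes expand: "\<And>u. norm u \<le> 1 \<Longrightarrow> \<bar>f (x + u) - f x - v \<bullet> u\<bar> \<le> K * (norm u)\<^sup>2"
    and extremum: "(\<forall>y. f y \<le> f x) \<or> (\<forall>y. f x \<le> f y)"
  shows "v = 0"
proof -
  obtain d where d: "0 < d" "\<And>h. 0 < h \<Longrightarrow> h \<le> d \<Longrightarrow> norm (h *\<^sub>R v) \<le> 1"
    using small_multiple[of v] by blast
  have "(norm v)\<^sup>2 \<le> 0"
  proof (rule le_of_small_perturbation[OF d(1)])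
    fix h :: real
    assume h: "0 < h" "h \<le> d"
    have 1: "\<bar>f (x + h *\<^sub>R v) - f x - v \<bullet> (h *\<^sub>R v)\<bar> \<le> K * (norm (h *\<^sub>R v))\<^sup>2"
      and 2: "\<bar>f (x + - (h *\<^sub>R v)) - f x - v \<bullet> (- (h *\<^sub>R v))\<bar> \<le> K * (norm (- (h *\<^sub>R v)))\<^sup>2"
      using d(2)[OF h] by (intro expand; simp)+
    have "v \<bullet> (h *\<^sub>R v) \<le> K * (norm (h *\<^sub>R v))\<^sup>2"
      using extremum
    proof (elim disjE)
      assume "\<forall>y. f y \<le> f x"
      then have "f (x + h *\<^sub>R v) \<le> f x"
        by blast
      with 1 show ?thesis
        by linarith
    next
      assume "\<forall>y. f x \<le> f y"
      then have "f x \<le> f (x + - (h *\<^sub>R v))"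
        by blast
      with 2 show ?thesis
        by simp
    qed
    then have "h * (norm v)\<^sup>2 \<le> h * (0 + K * (norm v)\<^sup>2 * h)"
      using h by (simp add: power2_norm_eq_inner[symmetric] power_mult_distrib power2_eq_square[of h] mult_ac)
    then show "(norm v)\<^sup>2 \<le> 0 + K * (norm v)\<^sup>2 * h"
      using h by simp
  qed
  then show ?thesis
    by simp
qed

text \<open>Let u = x - y, and let w have length |u| and the direction of e = g x - g y. The point x
  + w is reached from y directly and by way of x; comparing the expansions gives e . w <= K (|u +
  w|^2 + |w|^2 + |u|^2). The right side is at most (4 + 1 + 1) K |u|^2, whence the 6.\<close>

lemma gradient_lipschitz:
  fixes f :: "'a::real_inner \<Rightarrow> real"
  assumes expand: "\<And>x u. \<bar>f (x + u) - f x - g x \<bullet> u\<bar> \<le> K * (norm u)\<^sup>2"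
  shows "norm (g x - g y) \<le> 6 * K * norm (x - y)"
proof (cases "g x = g y \<or> x = y")
  case True
  have "0 \<le> K * (norm (x - y))\<^sup>2"
    using expand[of x "x - y"] by (meson abs_ge_zero order_trans)
  then show ?thesis
    using True by (auto simp: zero_le_mult_iff)
next
  case False
  define u where "u = x - y"
  define e where "e = g x - g y"
  define w where "w = (norm u / norm e) *\<^sub>R e"
  have e: "0 < norm e" and u: "0 < norm u"
    using False by (auto simp: e_def u_def)
  have nw: "norm w = norm u"
    using e by (simp add: w_def)
  have K: "0 \<le> K"
    using order_trans[OF abs_ge_zero expand[of x u]] u by (simp add: zero_le_mult_iff)
  have "\<bar>f (y + (u + w)) - f y - g y \<bullet> (u + w)\<bar> \<le> K * (norm (u + w))\<^sup>2"
    "\<bar>f (x + w) - f x - g x \<bullet> w\<bar> \<le> K * (norm w)\<^sup>2" "\<bar>f (y + u) - f y - g y \<bullet> u\<bar> \<le> K * (norm u)\<^sup>2"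
    by (rule expand)+
  moreover have "y + (u + w) = x + w" "y + u = x"
    by (auto simp: u_def)
  moreover have "g y \<bullet> (u + w) = g y \<bullet> u + g y \<bullet> w" "g x \<bullet> w = e \<bullet> w + g y \<bullet> w"
    by (simp_all add: inner_add_right e_def inner_diff_left)
  ultimately have "e \<bullet> w \<le> K * (norm (u + w))\<^sup>2 + K * (norm w)\<^sup>2 + K * (norm u)\<^sup>2"
    by (smt (verit))
  also have "K * (norm (u + w))\<^sup>2 \<le> K * (2 * norm u)\<^sup>2"
    using norm_triangle_ineq[of u w] nw K by (intro mult_left_mono power_mono) auto
  finally have "e \<bullet> w \<le> (6 * K * norm u) * norm u"
    by (simp add: nw power2_eq_square)
  also have "e \<bullet> w = norm e * norm u"
    using e by (simp add: w_def power2_norm_eq_inner[symmetric] power2_eq_square)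
  finally show ?thesis
    using u by (simp add: e_def u_def)
qed

text \<open>Squeezes [0,1] into [Phi(-r), Phi r]. The scaling factor is at most 1, so L is kept;
  this matters because L enters the final estimate, whereas K' may be anything.\<close>

lemma tame_rescale:
  fixes F :: "real ^ 'n \<Rightarrow> real"
  assumes F: "\<And>x. 0 \<le> F x" "\<And>x. F x \<le> 1"
    and lip: "\<And>x y. \<bar>F x - F y\<bar> \<le> L * norm (x - y)"
    and expand: "\<And>x u. norm u \<le> 1 \<Longrightarrow> \<bar>F (x + u) - F x - g x \<bullet> u\<bar> \<le> K * (norm u)\<^sup>2"
    and L: "0 \<le> L" and K: "0 \<le> K" and r: "0 \<le> r"
  obtains K' where "tame r L K' (\<lambda>x. Phi (-r) + (Phi r - Phi (-r)) * F x) (\<lambda>x. (Phi r - Phi (-r)) *\<^sub>R g x)"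
proof -
  define s where "s = Phi r - Phi (-r)"
  \<comment> \<open>For |u| > 1 the increment of F is at most 1 <= |u|^2 and the gradient term at
    most L |u|^2, which extends the expansion to all u.\<close>
  define K1 where "K1 = K + 1 + L"
  have s: "0 \<le> s" "s \<le> 1"
    using Phi_bounds[of r] Phi_bounds[of "-r"] r by (auto simp: s_def)
  have g: "norm (g x) \<le> L" for x
    by (rule gradient_norm_le[OF expand lip L])
  have expand1: "\<bar>F (x + u) - F x - g x \<bullet> u\<bar> \<le> K1 * (norm u)\<^sup>2" for x u
  proof (cases "norm u \<le> 1")
    case True
    have "K * (norm u)\<^sup>2 \<le> K1 * (norm u)\<^sup>2"
      using L by (intro mult_right_mono) (auto simp: K1_def)
    with expand[OF True, of x] show ?thesis
      by linarith
  next
    case False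
    then have u: "1 \<le> norm u" "norm u \<le> (norm u)\<^sup>2"
      using mult_left_mono[of 1 "norm u" "norm u"] by (auto simp: power2_eq_square)
    have "\<bar>g x \<bullet> u\<bar> \<le> norm (g x) * norm u"
      by (rule Cauchy_Schwarz_ineq2)
    also have "\<dots> \<le> L * (norm u)\<^sup>2"
      using g u L by (intro mult_mono) auto
    finally have "\<bar>g x \<bullet> u\<bar> \<le> L * (norm u)\<^sup>2" .
    moreover have "\<bar>F (x + u) - F x\<bar> \<le> (norm u)\<^sup>2"
      using F[of x] F[of "x + u"] u by linarith
    moreover have "0 \<le> K * (norm u)\<^sup>2"
      using K by simp
    ultimately show ?thesis
      unfolding K1_def distrib_right by linarith
  qed
  have K1: "0 \<le> K1"
    using K L by (simp add: K1_def)
  have scale: "s * a \<le> a" if "0 \<le> a" for a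
    using mult_right_mono[OF s(2) that] by simp
  have "tame r L (6 * K1) (\<lambda>x. Phi (-r) + s * F x) (\<lambda>x. s *\<^sub>R g x)"
    unfolding tame_def
  proof (intro conjI allI)
    fix x y u :: "real ^ 'n"
    have "0 \<le> s * F x" "s * F x \<le> s * 1"
      using mult_nonneg_nonneg[OF s(1) F(1)[of x]] mult_left_mono[OF F(2)[of x] s(1)] by auto
    then show "Phi (-r) + s * F x \<in> {Phi (-r)..Phi r}"
      by (simp add: s_def)
    have "\<bar>(Phi (-r) + s * F x) - (Phi (-r) + s * F y)\<bar> = s * \<bar>F x - F y\<bar>"
      using s by (simp add: right_diff_distrib[symmetric] abs_mult)
    also have "\<dots> \<le> \<bar>F x - F y\<bar>"
      by (rule scale) simp
    also have "\<dots> \<le> L * norm (x - y)"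
      by (rule lip)
    finally show "\<bar>(Phi (-r) + s * F x) - (Phi (-r) + s * F y)\<bar> \<le> L * norm (x - y)" .
    show "norm (s *\<^sub>R g x) \<le> L"
      using scale[of "norm (g x)"] g[of x] s by simp
    have "norm (s *\<^sub>R g x - s *\<^sub>R g y) = s * norm (g x - g y)"
      using s by (simp add: scaleR_diff_right[symmetric])
    also have "\<dots> \<le> norm (g x - g y)"
      by (rule scale) simp
    also have "\<dots> \<le> 6 * K1 * norm (x - y)"
      by (rule gradient_lipschitz[OF expand1])
    finally show "norm (s *\<^sub>R g x - s *\<^sub>R g y) \<le> 6 * K1 * norm (x - y)" .
    have "\<bar>(Phi (-r) + s * F (x + u)) - (Phi (-r) + s * F x) - (s *\<^sub>R g x) \<bullet> u\<bar> =
        s * \<bar>F (x + u) - F x - g x \<bullet> u\<bar>"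
      using s by (simp add: right_diff_distrib[symmetric] abs_mult)
    also have "\<dots> \<le> \<bar>F (x + u) - F x - g x \<bullet> u\<bar>"
      by (rule scale) simp
    also have "\<dots> \<le> 6 * K1 * (norm u)\<^sup>2"
      using expand1[of x u] mult_nonneg_nonneg[OF K1, of "(norm u)\<^sup>2"] by simp
    finally show "\<bar>(Phi (-r) + s * F (x + u)) - (Phi (-r) + s * F x) - (s *\<^sub>R g x) \<bullet> u\<bar> \<le>
        6 * K1 * (norm u)\<^sup>2" .
  qed
  then show ?thesis
    unfolding s_def by (rule that)
qed

text \<open>Of class \<open>C\<^sup>1\<close> with Lipschitz gradient, which is all that is needed of the mollifier.\<close>

definition bump :: "real \<Rightarrow> 'a::euclidean_space \<Rightarrow> real" where
  "bump \<theta> w = (max 0 (\<theta>\<^sup>2 - (norm w)\<^sup>2))\<^sup>2"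

definition bump_grad :: "real \<Rightarrow> 'a::euclidean_space \<Rightarrow> 'a" where
  "bump_grad \<theta> w = (- 4 * max 0 (\<theta>\<^sup>2 - (norm w)\<^sup>2)) *\<^sub>R w"

lemma bump_eq_0: "0 \<le> \<theta> \<Longrightarrow> \<theta> \<le> norm w \<Longrightarrow> bump \<theta> w = 0 \<and> bump_grad \<theta> w = 0"
  by (simp add: bump_def bump_grad_def power_mono)

lemma bump_measurable [measurable]:
  "bump \<theta> \<in> borel_measurable borel" "bump_grad \<theta> \<in> borel_measurable borel"
  unfolding bump_def[abs_def] bump_grad_def[abs_def] by measurable

text \<open>For |u| <= 1 and y outside the ball of radius \<theta> + 1, both points lie outside the
  support. The indicator makes the error integrable in y, as the convolution requires.\<close>

lemma bump_expand:
  fixes y u :: "'a::euclidean_space"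
  assumes \<theta>: "0 \<le> \<theta>" and u: "norm u \<le> 1"
  shows "\<bar>bump \<theta> (y + u) - bump \<theta> y - bump_grad \<theta> y \<bullet> u\<bar> \<le>
    ((2 * \<theta> + 3)\<^sup>2 + 2 * \<theta>\<^sup>2) * (norm u)\<^sup>2 * indicator (cball 0 (\<theta> + 1)) y"
proof (cases "norm y \<le> \<theta> + 1")
  case True
  define s where "s = \<theta>\<^sup>2 - (norm (y + u))\<^sup>2"
  define t where "t = \<theta>\<^sup>2 - (norm y)\<^sup>2"
  define p where "p = max 0 t"
  \<comment> \<open>The function (max 0 p)^2 has the 2-Lipschitz derivative 2 max 0 p, so its
    first-order remainder is at most (s - t)^2.\<close>
  have sq: "\<bar>(max 0 s)\<^sup>2 - (max 0 t)\<^sup>2 - 2 * max 0 t * (s - t)\<bar> \<le> (s - t)\<^sup>2"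
  proof (cases "0 \<le> s"; cases "0 \<le> t")
    assume "0 \<le> s" "0 \<le> t"
    moreover have "s\<^sup>2 - t\<^sup>2 - 2 * t * (s - t) = (s - t)\<^sup>2"
      by (simp add: power2_eq_square algebra_simps)
    ultimately show ?thesis
      by simp
  next
    assume "0 \<le> s" "\<not> 0 \<le> t"
    then show ?thesis
      by (auto intro!: power_mono)
  next
    assume "\<not> 0 \<le> s" "0 \<le> t"
    then have "s * s \<ge> 0" "t * s \<le> 0" "t * t \<ge> 0"
      by (auto simp: mult_nonneg_nonpos)
    then have "\<bar>t * t - 2 * (t * s)\<bar> \<le> s * s - 2 * (t * s) + t * t"
      by linarith
    moreover have "max 0 s = 0" "max 0 t = t"
      using \<open>\<not> 0 \<le> s\<close> \<open>0 \<le> t\<close> by auto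
    moreover have "0\<^sup>2 - t\<^sup>2 - 2 * t * (s - t) = t * t - 2 * (t * s)"
      by (simp add: power2_eq_square algebra_simps)
    moreover have "(s - t)\<^sup>2 = s * s - 2 * (t * s) + t * t"
      by (simp add: power2_eq_square algebra_simps)
    ultimately show ?thesis
      by simp
  next
    assume "\<not> 0 \<le> s" "\<not> 0 \<le> t"
    then show ?thesis
      by simp
  qed
  have st: "s - t = - 2 * (y \<bullet> u) - (norm u)\<^sup>2"
    by (simp add: s_def t_def power2_norm_eq_inner inner_add_left inner_add_right inner_commute)
  have "bump \<theta> (y + u) - bump \<theta> y - bump_grad \<theta> y \<bullet> u =
      ((max 0 s)\<^sup>2 - (max 0 t)\<^sup>2 - 2 * max 0 t * (s - t)) - 2 * p * (norm u)\<^sup>2"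
    unfolding st by (simp add: bump_def bump_grad_def s_def t_def p_def algebra_simps)
  also have "\<bar>\<dots>\<bar> \<le> (s - t)\<^sup>2 + 2 * \<theta>\<^sup>2 * (norm u)\<^sup>2"
  proof -
    have "0 \<le> p" "p \<le> \<theta>\<^sup>2"
      by (auto simp: p_def t_def)
    then have "0 \<le> p * (norm u)\<^sup>2" "p * (norm u)\<^sup>2 \<le> \<theta>\<^sup>2 * (norm u)\<^sup>2"
      by (auto intro: mult_right_mono)
    with sq show ?thesis
      by linarith
  qed
  also have "(s - t)\<^sup>2 \<le> (2 * \<theta> + 3)\<^sup>2 * (norm u)\<^sup>2"
  proof -
    have "\<bar>s - t\<bar> \<le> 2 * \<bar>y \<bullet> u\<bar> + (norm u)\<^sup>2"
      unfolding st using zero_le_power2[of "norm u"] by linarith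
    also have "\<dots> \<le> 2 * ((\<theta> + 1) * norm u) + 1 * norm u"
    proof (intro add_mono mult_left_mono)
      have "\<bar>y \<bullet> u\<bar> \<le> norm y * norm u"
        by (rule Cauchy_Schwarz_ineq2)
      also have "\<dots> \<le> (\<theta> + 1) * norm u"
        by (intro mult_right_mono True) simp
      finally show "\<bar>y \<bullet> u\<bar> \<le> (\<theta> + 1) * norm u" .
      show "(norm u)\<^sup>2 \<le> 1 * norm u"
        using u unfolding power2_eq_square by (intro mult_right_mono) auto
    qed simp
    also have "\<dots> = (2 * \<theta> + 3) * norm u"
      by (simp add: algebra_simps)
    finally have "\<bar>s - t\<bar>\<^sup>2 \<le> ((2 * \<theta> + 3) * norm u)\<^sup>2"
      by (intro power_mono) auto
    then show ?thesis
      by (simp only: power_mult_distrib power2_abs)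
  qed
  finally show ?thesis
    using True by (simp add: power_mult_distrib distrib_right)
next
  case False
  then have "\<theta> \<le> norm y" "\<theta> \<le> norm (y + u)"
    using u norm_diff_ineq[of y u] by auto
  then show ?thesis
    using False \<theta> by (simp add: bump_eq_0)
qed

lemma bump_bounds:
  fixes w :: "'a::euclidean_space"
  assumes "0 \<le> \<theta>"
  shows "0 \<le> bump \<theta> w" "bump \<theta> w \<le> \<theta> ^ 4 * indicator (cball 0 \<theta>) w"
    "norm (bump_grad \<theta> w) \<le> 4 * \<theta> ^ 3 * indicator (cball 0 \<theta>) w"
proof -
  show "0 \<le> bump \<theta> w"
    by (simp add: bump_def)
  have m: "max 0 (\<theta>\<^sup>2 - (norm w)\<^sup>2) \<le> \<theta>\<^sup>2"
    by simp
  have "bump \<theta> w \<le> (\<theta>\<^sup>2)\<^sup>2"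
    unfolding bump_def by (intro power_mono m) simp
  then show "bump \<theta> w \<le> \<theta> ^ 4 * indicator (cball 0 \<theta>) w"
    using bump_eq_0[OF assms, of w] by (cases "norm w \<le> \<theta>") auto
  show "norm (bump_grad \<theta> w) \<le> 4 * \<theta> ^ 3 * indicator (cball 0 \<theta>) w"
  proof (cases "norm w \<le> \<theta>")
    case True
    have "max 0 (\<theta>\<^sup>2 - (norm w)\<^sup>2) * norm w \<le> \<theta>\<^sup>2 * \<theta>"
      by (intro mult_mono m True) auto
    then show ?thesis
      using True by (simp add: bump_grad_def power2_eq_square power3_eq_cube)
  next
    case False
    then show ?thesis
      using bump_eq_0[OF assms, of w] by simp
  qed
qed

lemma integrable_cball_bound:
  fixes h :: "'a::euclidean_space \<Rightarrow> 'b::{banach, second_countable_topology}"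
  assumes "h \<in> borel_measurable borel" and "\<And>w. norm (h w) \<le> C * indicator (cball a R) w"
  shows "integrable lborel h"
proof (rule Bochner_Integration.integrable_bound)
  show "integrable lborel (\<lambda>w. C * indicator (cball a R) w :: real)"
    by (intro integrable_mult_right integrable_real_indicator)
      (use emeasure_bounded_finite[OF bounded_cball[of a R]] in auto)
  show "AE w in lborel. norm (h w) \<le> norm (C * indicator (cball a R) w :: real)"
    using assms(2) by (intro AE_I2) (metis abs_ge_self order_trans real_norm_def)
qed (use assms(1) in simp)

lemma lborel_integral_translate:
  fixes h :: "'a::euclidean_space \<Rightarrow> 'b::{banach, second_countable_topology}"
  assumes "h \<in> borel_measurable borel"
  shows "(\<integral>w. h (x + w) \<partial>lborel) = (\<integral>z. h z \<partial>lborel)"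
proof -
  have "(\<integral>z. h z \<partial>lborel) = (\<integral>z. h z \<partial>distr lborel borel ((+) x))"
    by (simp add: lborel_distr_plus)
  also have "\<dots> = (\<integral>w. h (x + w) \<partial>lborel)"
    using assms by (subst integral_distr) auto
  finally show ?thesis ..
qed

text \<open>Convolution with the bump, normalised to mass 1. As an average of translates of f, it
  inherits the range, the Lipschitz constant and local constancy at scale \<theta>. Written with the
  increment on the bump, it inherits the second-order expansion of the bump.\<close>

lemma mollify:
  fixes f :: "'a::euclidean_space \<Rightarrow> real"
  assumes \<theta>: "0 < \<theta>" and f: "\<And>x. 0 \<le> f x" "\<And>x. f x \<le> 1"
    and lip: "\<And>x y. \<bar>f x - f y\<bar> \<le> L * norm (x - y)" and L: "0 \<le> L"
  obtains F g K where "0 \<le> K" "\<And>x. 0 \<le> F x" "\<And>x. F x \<le> 1"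
    "\<And>x y. \<bar>F x - F y\<bar> \<le> L * norm (x - y)"
    "\<And>x u. norm u \<le> 1 \<Longrightarrow> \<bar>F (x + u) - F x - g x \<bullet> u\<bar> \<le> K * (norm u)\<^sup>2"
    "\<And>x c. (\<And>w. norm w \<le> \<theta> \<Longrightarrow> f (x + w) = c) \<Longrightarrow> F x = c"
proof -
  let ?q = "bump \<theta> :: 'a \<Rightarrow> real"
  define Z where "Z = (\<integral>w. ?q w \<partial>lborel)"
  define F where "F x = (\<integral>w. f (x + w) * ?q w \<partial>lborel) / Z" for x
  define g where "g x = (1 / Z) *\<^sub>R (\<integral>z. f z *\<^sub>R bump_grad \<theta> (x - z) \<partial>lborel)" for x
  define C where "C = (2 * \<theta> + 3)\<^sup>2 + 2 * \<theta>\<^sup>2"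
  define B where "B = measure lborel (cball (0 :: 'a) (\<theta> + 1))"
  have \<theta>0: "0 \<le> \<theta>"
    using \<theta> by simp
  note bb = bump_bounds[OF \<theta>0]
  have [measurable]: "f \<in> borel_measurable borel"
    by (rule borel_measurable_continuous_onI, rule continuous_on_lipschitz_bound[of f L])
      (use lip L in auto)
  have Iq: "integrable lborel ?q"
    by (rule integrable_cball_bound[of _ "\<theta> ^ 4" 0 \<theta>]) (simp_all add: bb(1,2))
  have Z: "0 < Z"
  proof -
    \<comment> \<open>On the ball of half the radius the bump is at least (\<theta>^2 /
      2)^2.\<close>
    have "(\<integral>w. (\<theta> ^ 4 / 4) * indicator (ball (0 :: 'a) (\<theta> / 2)) w \<partial>lborel) \<le> Z"
      unfolding Z_def
    proof (rule integral_mono[OF _ Iq])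
      show "integrable lborel (\<lambda>w. (\<theta> ^ 4 / 4) * indicator (ball (0 :: 'a) (\<theta> / 2)) w)"
        by (intro integrable_mult_right integrable_real_indicator)
          (use emeasure_bounded_finite[OF bounded_ball[of "0 :: 'a" "\<theta> / 2"]] in auto)
      show "(\<theta> ^ 4 / 4) * indicator (ball (0 :: 'a) (\<theta> / 2)) w \<le> ?q w" for w :: 'a
      proof (cases "norm w < \<theta> / 2")
        case True
        have "(norm w)\<^sup>2 \<le> (\<theta> / 2)\<^sup>2"
          using True by (intro power_mono) auto
        moreover have "(\<theta> / 2)\<^sup>2 = \<theta>\<^sup>2 / 4" "0 \<le> \<theta>\<^sup>2"
          by (simp_all add: power_divide)
        ultimately have "\<theta>\<^sup>2 / 2 \<le> \<theta>\<^sup>2 - (norm w)\<^sup>2"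
          by linarith
        then have "\<theta>\<^sup>2 / 2 \<le> max 0 (\<theta>\<^sup>2 - (norm w)\<^sup>2)"
          by (rule max.coboundedI2)
        then have "(\<theta>\<^sup>2 / 2)\<^sup>2 \<le> ?q w"
          unfolding bump_def by (intro power_mono) auto
        then show ?thesis
          using True by (simp add: power_divide)
      next
        case False
        then show ?thesis
          using bb(1) by simp
      qed
    qed
    moreover have "0 < measure lborel (ball (0 :: 'a) (\<theta> / 2))"
      using content_ball_pos[of "\<theta> / 2" "0 :: 'a"] \<theta> by simp
    then have "0 < \<theta> ^ 4 / 4 * measure lborel (ball (0 :: 'a) (\<theta> / 2))"
      using \<theta> by (intro mult_pos_pos) auto
    ultimately show ?thesis
      by simp
  qed
  have Ifq: "integrable lborel (\<lambda>w. f (x + w) * ?q w)" for x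
  proof (rule integrable_cball_bound[of _ "\<theta> ^ 4" 0 \<theta>])
    show "norm (f (x + w) * ?q w) \<le> \<theta> ^ 4 * indicator (cball 0 \<theta>) w" for w
      using mult_mono[OF f(2) bb(2)[of w], of "x + w"] bb(1)[of w] f(1)[of "x + w"]
      by (simp add: abs_mult)
  qed measurable
  \<comment> \<open>The substitution z = x + w and evenness of the bump move the dependence on x
    from f to the bump.\<close>
  have F_shift: "F x = (\<integral>z. f z * ?q (x - z) \<partial>lborel) / Z" for x
    using lborel_integral_translate[of "\<lambda>z. f z * ?q (x - z)" x]
    by (simp add: F_def bump_def)
  have ind: "indicator (cball 0 R) (x - z) = (indicator (cball x R) z :: real)" for x z :: 'a and R
    by (simp add: indicator_def dist_norm norm_minus_commute)
  have If: "integrable lborel (\<lambda>z. f z * ?q (x - z))" for x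
  proof (rule integrable_cball_bound[of _ "\<theta> ^ 4" x \<theta>])
    show "norm (f z * ?q (x - z)) \<le> \<theta> ^ 4 * indicator (cball x \<theta>) z" for z
      using mult_mono[OF f(2) bb(2)[of "x - z"], of z] bb(1)[of "x - z"] f(1)[of z]
      by (simp add: abs_mult ind)
  qed measurable
  have Ig: "integrable lborel (\<lambda>z. f z *\<^sub>R bump_grad \<theta> (x - z))" for x
  proof (rule integrable_cball_bound[of _ "4 * \<theta> ^ 3" x \<theta>])
    show "norm (f z *\<^sub>R bump_grad \<theta> (x - z)) \<le> 4 * \<theta> ^ 3 * indicator (cball x \<theta>) z" for z
      using mult_mono[OF f(2) bb(3)[of "x - z"], of z] f(1)[of z]
      by (simp add: ind)
  qed measurable
  show thesis
  proof (rule that)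
    show "0 \<le> C * B / Z"
      using Z by (simp add: C_def B_def)
    show "0 \<le> F x" for x
      using Z f(1) bb(1) unfolding F_def
      by (intro divide_nonneg_pos integral_nonneg_AE AE_I2 mult_nonneg_nonneg) auto
    show "F x \<le> 1" for x
    proof -
      have "(\<integral>w. f (x + w) * ?q w \<partial>lborel) \<le> Z"
        unfolding Z_def
        using mult_right_mono[OF f(2) bb(1)] by (intro integral_mono Ifq Iq) simp
      then show ?thesis
        using Z by (simp add: F_def)
    qed
    show "\<bar>F x - F y\<bar> \<le> L * norm (x - y)" for x y
    proof -
      have "(\<integral>w. f (x + w) * ?q w \<partial>lborel) - (\<integral>w. f (y + w) * ?q w \<partial>lborel) =
          (\<integral>w. f (x + w) * ?q w - f (y + w) * ?q w \<partial>lborel)"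
        using Ifq by simp
      also have "\<bar>\<dots>\<bar> \<le> (\<integral>w. L * norm (x - y) * ?q w \<partial>lborel)"
      proof (rule integral_abs_bound_integral)
        show "\<bar>f (x + w) * ?q w - f (y + w) * ?q w\<bar> \<le> L * norm (x - y) * ?q w" for w
          using mult_right_mono[OF lip[of "x + w" "y + w"] bb(1)[of w]] bb(1)[of w]
          by (simp add: left_diff_distrib[symmetric] abs_mult)
      qed (use Ifq Iq in auto)
      also have "\<dots> = L * norm (x - y) * Z"
        by (simp add: Z_def)
      finally show ?thesis
        using Z by (simp add: F_def diff_divide_distrib[symmetric] abs_divide pos_divide_le_eq)
    qed
    show "\<bar>F (x + u) - F x - g x \<bullet> u\<bar> \<le> C * B / Z * (norm u)\<^sup>2" if u: "norm u \<le> 1" for x u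
    proof -
      let ?e = "\<lambda>z. ?q (x - z + u) - ?q (x - z) - bump_grad \<theta> (x - z) \<bullet> u"
      have Ifu: "integrable lborel (\<lambda>z. f z * ?q (x - z + u))"
        using If[of "x + u"] by (simp add: algebra_simps)
      have Igu: "integrable lborel (\<lambda>z. f z * (bump_grad \<theta> (x - z) \<bullet> u))"
        using integrable_inner_left[OF Ig[of x], of u] by simp
      have Fu: "F (x + u) = (\<integral>z. f z * ?q (x - z + u) \<partial>lborel) / Z"
        unfolding F_shift by (simp add: algebra_simps)
      have gu: "g x \<bullet> u = (\<integral>z. f z * (bump_grad \<theta> (x - z) \<bullet> u) \<partial>lborel) / Z"
        using integral_inner_left[OF Ig[of x], of u] by (simp add: g_def)
      have "F (x + u) - F x - g x \<bullet> u = (\<integral>z. f z * ?q (x - z + u) \<partial>lborel) / Z -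
          (\<integral>z. f z * ?q (x - z) \<partial>lborel) / Z - (\<integral>z. f z * (bump_grad \<theta> (x - z) \<bullet> u) \<partial>lborel) / Z"
        unfolding Fu gu F_shift[of x] ..
      also have "\<dots> = (\<integral>z. f z * ?e z \<partial>lborel) / Z"
        unfolding right_diff_distrib diff_divide_distrib[symmetric]
        using Ifu If[of x] Igu by simp
      finally have eq: "F (x + u) - F x - g x \<bullet> u = (\<integral>z. f z * ?e z \<partial>lborel) / Z" .
      have "\<bar>\<integral>z. f z * ?e z \<partial>lborel\<bar> \<le> (\<integral>z. C * (norm u)\<^sup>2 * indicator (cball x (\<theta> + 1)) z \<partial>lborel)"
      proof (rule integral_abs_bound_integral)
        show "integrable lborel (\<lambda>z. f z * ?e z)"
          unfolding right_diff_distrib using Ifu If[of x] Igu by simp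
        show "integrable lborel (\<lambda>z. C * (norm u)\<^sup>2 * indicator (cball x (\<theta> + 1)) z)"
          by (intro integrable_mult_right integrable_real_indicator)
            (use emeasure_bounded_finite[OF bounded_cball[of x "\<theta> + 1"]] in auto)
        fix z
        have "\<bar>f z * ?e z\<bar> = f z * \<bar>?e z\<bar>"
          using f(1)[of z] by (simp add: abs_mult)
        also have "\<dots> \<le> 1 * (C * (norm u)\<^sup>2 * indicator (cball 0 (\<theta> + 1)) (x - z))"
          unfolding C_def by (intro mult_mono f bump_expand[OF \<theta>0 u]) auto
        finally show "\<bar>f z * ?e z\<bar> \<le> C * (norm u)\<^sup>2 * indicator (cball x (\<theta> + 1)) z"
          by (simp only: ind mult_1)
      qed
      also have "\<dots> = C * (norm u)\<^sup>2 * measure lborel (cball x (\<theta> + 1))"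
        by simp
      also have "measure lborel (cball x (\<theta> + 1)) = B"
        using \<theta> by (simp add: B_def content_cball)
      finally have "\<bar>\<integral>z. f z * ?e z \<partial>lborel\<bar> / Z \<le> C * (norm u)\<^sup>2 * B / Z"
        using Z by (intro divide_right_mono) auto
      then show ?thesis
        unfolding eq using Z by (simp add: abs_divide mult_ac)
    qed
    show "F x = c" if "\<And>w. norm w \<le> \<theta> \<Longrightarrow> f (x + w) = c" for x c
    proof -
      have "f (x + w) * ?q w = c * ?q w" for w
        using that[of w] bump_eq_0[OF \<theta>0, of w] by (cases "norm w \<le> \<theta>") auto
      then have "F x = (\<integral>w. c * ?q w \<partial>lborel) / Z"
        unfolding F_def by (simp only:)
      also have "\<dots> = c * Z / Z"
        unfolding Z_def by simp
      finally show ?thesis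
        using Z by simp
    qed
  qed
qed

section \<open>The Gaussian profile\<close>

lemma enlargement_gauss:
  "psi_enlargement (std_gaussian :: (real ^ 'n) measure) id \<epsilon> A = (\<Union>y\<in>A. ball y \<epsilon>)"
  by (auto simp: psi_enlargement_eq dist_norm norm_minus_commute)

lemma abs_clamp_diff_le: "\<bar>min 1 (max 0 a) - min 1 (max 0 b)\<bar> \<le> \<bar>a - b :: real\<bar>"
  by (auto simp: min_def max_def)

text \<open>Here p is the Gaussian mean of a mollified plateau function F that is 1 on A and 0 off
  the enlargement U. After squeezing, Bobkov's integrand is \<phi> r off U - A and at most 1 + L on
  U - A, where L is the slope. The range of p is restricted because I is continuous only on
  (0,1).\<close>

lemma giso_le_enlargement:
  fixes A :: "(real ^ 'n) set"
  defines "G \<equiv> std_gaussian :: (real ^ 'n) measure"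
  assumes A: "A \<in> sets borel" "A \<noteq> {}" and \<theta>: "0 < \<theta>" "2 * \<theta> < \<epsilon>"
  obtains p where "measure G A \<le> p" "p \<le> measure G (\<Union>y\<in>A. ball y \<epsilon>)"
    "0 < p \<Longrightarrow> p < 1 \<Longrightarrow>
      giso p \<le> (measure G (\<Union>y\<in>A. ball y \<epsilon>) - measure G A) * (1 + 1 / (\<epsilon> - 2 * \<theta>))"
proof -
  define U where "U = (\<Union>y\<in>A. ball y \<epsilon>)"
  define L where "L = 1 / (\<epsilon> - 2 * \<theta>)"
  \<comment> \<open>Equal to 1 up to distance \<theta> from A and to 0 from distance \<epsilon> -
    \<theta> on. Mollification at radius \<theta> thus keeps both plateaus, and the remaining width
    \<epsilon> - 2 \<theta> fixes the slope.\<close>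
  define f where "f z = min 1 (max 0 ((\<epsilon> - \<theta> - infdist z A) * L))" for z
  have L: "0 < L"
    using \<theta> by (simp add: L_def)
  have U: "U \<in> sets borel"
    unfolding U_def by (intro borel_open) auto
  have "A \<subseteq> U"
    using \<theta> by (force simp: U_def)
  have far: "\<epsilon> \<le> infdist x A" if "x \<notin> U" for x
  proof -
    have "\<epsilon> \<le> dist x a" if "a \<in> A" for a
      using \<open>x \<notin> U\<close> that by (auto simp: U_def dist_commute not_less[symmetric])
    then show ?thesis
      using A(2) by (simp add: infdist_notempty cINF_greatest)
  qed
  have infdist_diff: "\<bar>infdist x A - infdist y A\<bar> \<le> norm (x - y)" for x y
    using infdist_triangle_abs[of x A y] by (simp add: dist_norm)
  have f: "0 \<le> f x" "f x \<le> 1" for x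
    by (auto simp: f_def)
  have f_lip: "\<bar>f x - f y\<bar> \<le> L * norm (x - y)" for x y
  proof -
    have "\<bar>f x - f y\<bar> \<le> \<bar>(\<epsilon> - \<theta> - infdist x A) * L - (\<epsilon> - \<theta> - infdist y A) * L\<bar>"
      unfolding f_def by (rule abs_clamp_diff_le)
    also have "\<dots> = \<bar>(infdist y A - infdist x A) * L\<bar>"
      by (simp add: algebra_simps)
    also have "\<dots> = L * \<bar>infdist x A - infdist y A\<bar>"
      using L by (simp add: abs_mult abs_minus_commute)
    also have "\<dots> \<le> L * norm (x - y)"
      using L infdist_diff by (intro mult_left_mono) auto
    finally show ?thesis .
  qed
  obtain F g K where K: "0 \<le> K" and F: "\<And>x. 0 \<le> F x" "\<And>x. F x \<le> 1"
    and F_lip: "\<And>x y. \<bar>F x - F y\<bar> \<le> L * norm (x - y)"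
    and expand: "\<And>x u. norm u \<le> 1 \<Longrightarrow> \<bar>F (x + u) - F x - g x \<bullet> u\<bar> \<le> K * (norm u)\<^sup>2"
    and const: "\<And>x c. (\<And>w. norm w \<le> \<theta> \<Longrightarrow> f (x + w) = c) \<Longrightarrow> F x = c"
    using mollify[OF \<theta>(1) f f_lip less_imp_le[OF L]] by metis
  have F_in: "F x = 1" if "x \<in> A" for x
  proof (rule const)
    fix w :: "real ^ 'n"
    assume "norm w \<le> \<theta>"
    then have "infdist (x + w) A \<le> \<theta>"
      using infdist_diff[of "x + w" x] that by simp
    then have "(\<epsilon> - 2 * \<theta>) * L \<le> (\<epsilon> - \<theta> - infdist (x + w) A) * L"
      using L by (intro mult_right_mono) auto
    moreover have "(\<epsilon> - 2 * \<theta>) * L = 1"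
      using \<theta> by (simp add: L_def)
    ultimately show "f (x + w) = 1"
      by (simp add: f_def)
  qed
  have F_out: "F x = 0" if "x \<notin> U" for x
  proof (rule const)
    fix w :: "real ^ 'n"
    assume "norm w \<le> \<theta>"
    then have "\<epsilon> - \<theta> - infdist (x + w) A \<le> 0"
      using infdist_diff[of "x + w" x] far[OF that] by simp
    then have "(\<epsilon> - \<theta> - infdist (x + w) A) * L \<le> 0"
      using L by (simp add: mult_nonpos_nonneg)
    then show "f (x + w) = 0"
      by (simp add: f_def)
  qed
  have g0: "g x = 0" if "x \<notin> U - A" for x
  proof (rule gradient_eq_0[where f = F and x = x])
    show "(\<forall>y. F y \<le> F x) \<or> (\<forall>y. F x \<le> F y)"
      using that F_in[of x] F_out[of x] F by auto
  qed (rule expand)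
  have g_le: "norm (g x) \<le> L" for x
    by (rule gradient_norm_le[OF expand F_lip less_imp_le[OF L]])
  have [measurable]: "F \<in> borel_measurable borel"
    by (rule borel_measurable_continuous_onI, rule continuous_on_lipschitz_bound[of F L])
      (use F_lip L in auto)
  have IF: "integrable G F"
    unfolding G_def using F by (intro gauss.integrable_const_bound[where B = 1]) auto
  have [measurable]: "A \<in> sets G" "U \<in> sets G"
    using A U by (auto simp: G_def)
  interpret G: prob_space G
    unfolding G_def by (rule prob_space_std_gaussian)
  have sp: "space G = UNIV"
    by (simp add: G_def)
  define p where "p = (\<integral>x. F x \<partial>G)"
  have intA: "integrable G (indicator A :: _ \<Rightarrow> real)" and intU: "integrable G (indicator U :: _ \<Rightarrow> real)"
    and intUA: "integrable G (indicator (U - A) :: _ \<Rightarrow> real)"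
    by (auto intro!: integrable_real_indicator simp: less_top[symmetric])
  show thesis
  proof (rule that)
    have "(\<integral>x. indicator A x \<partial>G) \<le> p"
      unfolding p_def
      by (intro integral_mono intA IF) (use F F_in in \<open>auto simp: indicator_def\<close>)
    then show "measure G A \<le> p"
      by (simp add: sp)
    have "p \<le> (\<integral>x. indicator U x \<partial>G)"
      unfolding p_def
      by (intro integral_mono intU IF) (use F F_out in \<open>auto simp: indicator_def\<close>)
    then show "p \<le> measure G (\<Union>y\<in>A. ball y \<epsilon>)"
      by (simp add: sp U_def)
    assume p: "0 < p" "p < 1"
    have diff: "measure G U - measure G A = measure G (U - A)"
      using \<open>A \<subseteq> U\<close> by (subst G.finite_measure_Diff) auto
    have bound: "giso (Phi (-r) + (Phi r - Phi (-r)) * p) \<le> \<phi> r + measure G (U - A) * (1 + L)"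
      if r: "0 \<le> r" for r
    proof -
      let ?s = "Phi r - Phi (-r)"
      let ?f = "\<lambda>x. Phi (-r) + ?s * F x" and ?g = "\<lambda>x. ?s *\<^sub>R g x"
      obtain K' where tame: "tame r L K' ?f ?g"
        using tame_rescale[OF F F_lip expand less_imp_le[OF L] K r] by metis
      have s: "0 \<le> ?s" "?s \<le> 1"
        using Phi_bounds[of r] Phi_bounds[of "-r"] r by auto
      have "giso (Phi (-r) + ?s * p) = giso (\<integral>x. ?f x \<partial>std_gaussian)"
        using IF unfolding G_def p_def by (simp)
      also have "\<dots> \<le> (\<integral>x. sqrt ((giso (?f x))\<^sup>2 + (norm (?g x))\<^sup>2) \<partial>std_gaussian)"
        by (rule bobkov_inequality[OF tame])
      also have "\<dots> = (\<integral>x. bobkov 1 ?f ?g x \<partial>G)"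
        by (simp add: bobkov_def G_def)
      also have "\<dots> \<le> (\<integral>x. \<phi> r + indicator (U - A) x * (1 + L) \<partial>G)"
      proof (rule integral_mono)
        show "integrable G (bobkov 1 ?f ?g)"
          using integrable_heat[OF bobkov_bounds(1,2)[OF tame, of 1], where x = 0 and t = 1]
          by (simp add: G_def)
        show "integrable G (\<lambda>x. \<phi> r + indicator (U - A) x * (1 + L))"
          using intUA by (intro Bochner_Integration.integrable_add G.integrable_const integrable_mult_left)
        fix x
        show "bobkov 1 ?f ?g x \<le> \<phi> r + indicator (U - A) x * (1 + L)"
        proof (cases "x \<in> U - A")
          case True
          then show ?thesis
            using bobkov_bounds(2)[OF tame, of 1 x] \<phi>_pos[of r] by simp
        next
          case False
          then have "F x = 0 \<or> F x = 1"
            using F_in[of x] F_out[of x] by auto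
          \<comment> \<open>The squeezed values are Phi(-r) and Phi r, and \<phi> is even.\<close>
          then have "giso (?f x) = \<phi> r"
          proof
            assume "F x = 0"
            then show ?thesis
              by (simp add: std_normal_density_def)
          next
            assume "F x = 1"
            then show ?thesis
              by simp
          qed
          then show ?thesis
            using g0[OF False] False \<phi>_pos[of r] by (simp add: bobkov_def)
        qed
      qed
      also have "\<dots> = \<phi> r + measure G (U - A) * (1 + L)"
        using intUA G.prob_space sp by simp
      finally show ?thesis .
    qed
    have "giso p \<le> 0 + measure G (U - A) * (1 + L)"
    proof (rule tendsto_le[of at_top])
      have Phi_uminus: "((\<lambda>r. Phi (-r)) \<longlongrightarrow> 0) at_top"
        using Phi_at_bot by (simp add: filterlim_at_bot_mirror)
      have "((\<lambda>r. Phi (-r) + (Phi r - Phi (-r)) * p) \<longlongrightarrow> 0 + (1 - 0) * p) at_top"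
        by (intro tendsto_intros Phi_at_top Phi_uminus)
      then show "((\<lambda>r. giso (Phi (-r) + (Phi r - Phi (-r)) * p)) \<longlongrightarrow> giso p) at_top"
        using isCont_tendsto_compose[OF isCont_giso[OF p]] by simp
      \<comment> \<open>From r <= 1 + r^2/2 <= exp(r^2/2).\<close>
      have "(\<phi> \<longlongrightarrow> 0) at_top"
      proof (rule tendsto_sandwich)
        show "eventually (\<lambda>r. \<phi> r \<le> inverse r) at_top"
          using eventually_gt_at_top[of 0]
        proof eventually_elim
          case (elim r)
          have "r \<le> 1 + r\<^sup>2 / 2"
            using zero_le_power2[of "r - 1"] by (simp add: power2_diff)
          also have "\<dots> \<le> exp (r\<^sup>2 / 2)"
            by (rule exp_ge_add_one_self)
          finally have "inverse (exp (r\<^sup>2 / 2)) \<le> inverse r"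
            using elim by (intro le_imp_inverse_le)
          moreover have "\<phi> r \<le> 1 * exp (- r\<^sup>2 / 2)"
            unfolding std_normal_density_def using pi_gt3
            by (intro mult_right_mono) (auto simp: real_le_rsqrt)
          ultimately show ?case
            by (simp add: exp_minus)
        qed
      qed (auto intro: tendsto_inverse_0_at_top filterlim_ident less_imp_le \<phi>_pos)
      then show "((\<lambda>r. \<phi> r + measure G (U - A) * (1 + L)) \<longlongrightarrow> 0 + measure G (U - A) * (1 + L)) at_top"
        by (intro tendsto_intros)
      show "eventually (\<lambda>r. giso (Phi (-r) + (Phi r - Phi (-r)) * p) \<le>
          \<phi> r + measure G (U - A) * (1 + L)) at_top"
        using eventually_ge_at_top[of 0] by eventually_elim (rule bound)
    qed simp
    then show "giso p \<le> (measure G (\<Union>y\<in>A. ball y \<epsilon>) - measure G A) * (1 + 1 / (\<epsilon> - 2 * \<theta>))"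
      using diff by (simp add: U_def L_def)
  qed
qed

text \<open>Let m be the mass gained by the enlargement and suppose m < c \<epsilon> with c < I(v).
  Then p is close to v, so I(p) exceeds some c' > c. The enlargement bound, however, keeps I(p)
  below c \<epsilon> + c / (1 - \<epsilon>), which tends to c.\<close>

lemma gauss_perimeter_ge:
  fixes A :: "(real ^ 'n) set"
  defines "G \<equiv> std_gaussian :: (real ^ 'n) measure"
  assumes A: "A \<in> sets borel" and v: "0 < measure G A" "measure G A < 1"
  shows "ereal (giso (measure G A)) \<le> psi_perimeter G id A"
proof (rule dense_le)
  define v where "v = measure G A"
  define m where "m \<epsilon> = measure G (\<Union>y\<in>A. ball y \<epsilon>) - v" for \<epsilon>
  note v = assms(3,4)[folded v_def]
  fix y assume y: "y < ereal (giso (measure G A))"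
  have "A \<noteq> {}"
    using assms(3) by auto
  have per: "psi_perimeter G id A = Liminf (at_right 0) (\<lambda>\<epsilon>. ereal (m \<epsilon> / \<epsilon>))"
    unfolding psi_perimeter_def G_def enlargement_gauss m_def v_def ..
  show "y \<le> psi_perimeter G id A"
  proof (cases y)
    case (real c)
    then have c: "c < giso v"
      using y by (simp add: v_def)
    define c' where "c' = (c + giso v) / 2"
    have c': "c < c'" "c' < giso v"
      using c by (auto simp: c'_def)
    have "isCont giso v"
      by (rule isCont_giso[OF v])
    then have "eventually (\<lambda>p. c' < giso p) (nhds v)"
      using c'(2) by (intro order_tendstoD(1)) (auto simp: isCont_def tendsto_at_iff_tendsto_nhds)
    moreover have "eventually (\<lambda>p. p < 1) (nhds v)"
      using v by (intro order_tendstoD(2)[OF filterlim_ident]) auto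
    ultimately have "eventually (\<lambda>p. c' < giso p \<and> p < 1) (nhds v)"
      by (rule eventually_conj)
    then obtain \<delta> where \<delta>: "0 < \<delta>" "\<And>p. dist p v < \<delta> \<Longrightarrow> c' < giso p \<and> p < 1"
      unfolding eventually_nhds_metric by blast
    have "((\<lambda>\<epsilon>. c * \<epsilon> + c / (1 - \<epsilon>)) \<longlongrightarrow> c * 0 + c / (1 - 0)) (at_right 0)"
      by (intro tendsto_intros) auto
    then have ev1: "eventually (\<lambda>\<epsilon>. c * \<epsilon> + c / (1 - \<epsilon>) < c') (at_right 0)"
      using c'(1) by (intro order_tendstoD(2)) auto
    have "((\<lambda>\<epsilon>. c * \<epsilon>) \<longlongrightarrow> c * 0) (at_right 0)"
      by (intro tendsto_intros)
    then have ev2: "eventually (\<lambda>\<epsilon>. c * \<epsilon> < \<delta>) (at_right 0)"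
      using \<delta>(1) by (intro order_tendstoD(2)) auto
    have ev3: "eventually (\<lambda>\<epsilon>::real. 0 < \<epsilon> \<and> \<epsilon> < 1) (at_right 0)"
      using eventually_at_right_real[of 0 1] by simp
    from ev1 ev2 ev3 have "eventually (\<lambda>\<epsilon>. ereal c \<le> ereal (m \<epsilon> / \<epsilon>)) (at_right 0)"
    proof eventually_elim
      case (elim \<epsilon>)
      \<comment> \<open>Of smaller order than \<epsilon>, so the slope 1 / (\<epsilon> - 2 \<theta>)
        = 1 / (\<epsilon> (1 - \<epsilon>)) is asymptotic to 1 / \<epsilon>.\<close>
      define \<theta> where "\<theta> = \<epsilon>\<^sup>2 / 2"
      have \<epsilon>: "0 < \<epsilon>" "\<epsilon> < 1"
        using elim by auto
      have \<theta>: "0 < \<theta>" "2 * \<theta> < \<epsilon>" "\<epsilon> - 2 * \<theta> = \<epsilon> * (1 - \<epsilon>)"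
        using \<epsilon> by (auto simp: \<theta>_def power2_eq_square algebra_simps)
      obtain p where p: "v \<le> p" "p \<le> v + m \<epsilon>"
        and giso: "0 < p \<Longrightarrow> p < 1 \<Longrightarrow> giso p \<le> m \<epsilon> * (1 + 1 / (\<epsilon> - 2 * \<theta>))"
        using giso_le_enlargement[OF A \<open>A \<noteq> {}\<close> \<theta>(1,2)] unfolding m_def v_def G_def by auto
      have "c \<le> m \<epsilon> / \<epsilon>"
      proof (rule ccontr)
        assume "\<not> c \<le> m \<epsilon> / \<epsilon>"
        then have m: "m \<epsilon> < c * \<epsilon>"
          using \<epsilon> by (simp add: not_le pos_divide_less_eq)
        then have "dist p v < \<delta>"
          using p elim by (auto simp: dist_real_def)
        from \<delta>(2)[OF this] p v have "giso p \<le> m \<epsilon> * (1 + 1 / (\<epsilon> - 2 * \<theta>))" "c' < giso p"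
          by (auto intro: giso)
        moreover have "m \<epsilon> * (1 + 1 / (\<epsilon> - 2 * \<theta>)) \<le> c * \<epsilon> * (1 + 1 / (\<epsilon> - 2 * \<theta>))"
          using m \<theta> by (intro mult_right_mono) auto
        moreover have "c * \<epsilon> * (1 + 1 / (\<epsilon> - 2 * \<theta>)) = c * \<epsilon> + c / (1 - \<epsilon>)"
          unfolding \<theta>(3) using \<epsilon> by (simp add: field_simps)
        ultimately show False
          using elim by linarith
      qed
      then show ?case
        by simp
    qed
    then show ?thesis
      unfolding per real by (rule Liminf_bounded)
  qed (use y in auto)
qed

text \<open>The enlargement lies in the half-space at level a + \<epsilon>, so the perimeter
  quotient is at most a difference quotient of Phi at a.\<close>

lemma gauss_half_space_perimeter_le:
  fixes b :: "real ^ 'n"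
  assumes b: "b \<in> Basis"
  shows "psi_perimeter std_gaussian id {x. x \<bullet> b \<le> a} \<le> ereal (\<phi> a)"
proof -
  let ?G = "std_gaussian :: (real ^ 'n) measure"
  have half: "measure ?G {x. x \<bullet> b \<le> c} = Phi c" for c
    using emeasure_std_gaussian_component[OF b, of "{..c}"]
    by (simp add: measure_def Phi_def cdf_def)
  have enl: "measure ?G (\<Union>y\<in>{x. x \<bullet> b \<le> a}. ball y \<epsilon>) \<le> Phi (a + \<epsilon>)" for \<epsilon>
  proof -
    have "(\<Union>y\<in>{x. x \<bullet> b \<le> a}. ball y \<epsilon>) \<subseteq> {x. x \<bullet> b \<le> a + \<epsilon>}"
    proof clarify
      fix x y
      assume "y \<bullet> b \<le> a" "x \<in> ball y \<epsilon>"
      moreover have "\<bar>(x - y) \<bullet> b\<bar> \<le> norm (x - y)"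
        by (rule Basis_le_norm[OF b])
      ultimately show "x \<bullet> b \<le> a + \<epsilon>"
        by (simp add: dist_norm norm_minus_commute inner_diff_left)
    qed
    moreover have "{x. x \<bullet> b \<le> a + \<epsilon>} \<in> sets ?G"
      using borel_closed[OF closed_halfspace_component_le[of b "a + \<epsilon>"]]
      by (simp add: inner_commute)
    ultimately show ?thesis
      unfolding half[symmetric] by (rule gauss.finite_measure_mono)
  qed
  have "((\<lambda>h. (Phi (a + h) - Phi a) / h) \<longlongrightarrow> \<phi> a) (at_right 0)"
    using DERIV_Phi[of a] unfolding DERIV_def
    by (rule tendsto_mono[OF at_le, rotated]) auto
  then have lim: "Liminf (at_right 0) (\<lambda>h. ereal ((Phi (a + h) - Phi a) / h)) = ereal (\<phi> a)"
    by (intro lim_imp_Liminf) auto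
  have "psi_perimeter ?G id {x. x \<bullet> b \<le> a} \<le> Liminf (at_right 0) (\<lambda>h. ereal ((Phi (a + h) - Phi a) / h))"
    unfolding psi_perimeter_def enlargement_gauss half
  proof (rule Liminf_mono)
    show "eventually (\<lambda>\<epsilon>. ereal ((measure ?G (\<Union>y\<in>{x. x \<bullet> b \<le> a}. ball y \<epsilon>) - Phi a) / \<epsilon>)
        \<le> ereal ((Phi (a + \<epsilon>) - Phi a) / \<epsilon>)) (at_right 0)"
      using eventually_at_right_less[of 0]
      by eventually_elim (use enl in \<open>simp add: divide_right_mono\<close>)
  qed
  with lim show ?thesis
    by simp
qed

lemma iso_profile_std_gaussian:
  assumes v: "0 < v" "v < 1"
  shows "iso_profile (std_gaussian :: (real ^ 'n) measure) id v = ereal (\<phi> (inv Phi v))"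
proof (rule antisym)
  let ?G = "std_gaussian :: (real ^ 'n) measure"
  obtain b :: "real ^ 'n" where b: "b \<in> Basis"
    using nonempty_Basis by blast
  let ?H = "{x. x \<bullet> b \<le> inv Phi v}"
  have "measure ?G ?H = v"
    using emeasure_std_gaussian_component[OF b, of "{..inv Phi v}"] Phi_inv[OF v]
    by (simp add: measure_def Phi_def cdf_def)
  moreover have "?H \<in> sets ?G"
    using borel_closed[OF closed_halfspace_component_le[of b "inv Phi v"]]
    by (simp add: inner_commute)
  ultimately have "iso_profile ?G id v \<le> psi_perimeter ?G id ?H"
    unfolding iso_profile_def by (intro Inf_lower) blast
  also have "\<dots> \<le> ereal (\<phi> (inv Phi v))"
    by (rule gauss_half_space_perimeter_le[OF b])
  finally show "iso_profile ?G id v \<le> ereal (\<phi> (inv Phi v))" .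
  show "ereal (\<phi> (inv Phi v)) \<le> iso_profile ?G id v"
    unfolding iso_profile_def
  proof (rule Inf_greatest)
    fix y assume "y \<in> {psi_perimeter ?G id A |A. A \<in> sets ?G \<and> measure ?G A = v}"
    then obtain A where "y = psi_perimeter ?G id A" "A \<in> sets borel" "measure ?G A = v"
      by auto
    then show "ereal (\<phi> (inv Phi v)) \<le> y"
      using gauss_perimeter_ge[of A] v by (simp add: giso_def)
  qed
qed

theorem theorem7p3:
  fixes k :: enat
    and X :: "'a topology"
    and \<A> :: "('a, 'e::euclidean_space) chart set"
    and \<mu> :: "'a measure"
    and \<psi> :: "'a \<Rightarrow> real ^ 'n"
  assumes "1 \<le> k"
    and "Ck_manifold k X \<A>"
    and "prob_space \<mu>"
    and "sets \<mu> = sets (borel_of X)"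
    and "Ck_diffeomorphism k X \<A> euclidean euclidean_atlas \<psi>"
  shows "iso_profile \<mu> \<psi> = iso_profile (distr \<mu> borel \<psi>) id \<and>
    (distr \<mu> borel \<psi> = std_gaussian \<longrightarrow>
      (\<forall>v\<in>{0<..<1}. iso_profile \<mu> \<psi> v = ereal (std_normal_density (inv Phi v))))"
proof -
  \<comment> \<open>\<open>Ck_map\<close> contains continuity, so \<psi> and g are mutually inverse
    homeomorphisms; the second inverse law holds for all y because \<open>topspace euclidean\<close>
    is the whole space.\<close>
  obtain g where "continuous_map X euclidean \<psi>" "continuous_map euclidean X g"
    "\<forall>x\<in>topspace X. g (\<psi> x) = x" "\<forall>y. \<psi> (g y) = y"
    using assms(5) unfolding Ck_diffeomorphism_def Ck_map_def by auto
  then have "iso_profile \<mu> \<psi> = iso_profile (distr \<mu> borel \<psi>) id"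
    by (intro iso_profile_homeomorphism[OF assms(4)]) auto
  then show ?thesis
    by (simp add: iso_profile_std_gaussian)
qed

end
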